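(* Let $\alpha$ be irrational with an adjusted nearest integer expansion $(a_0;\varepsilon_1a_1,\varepsilon_2a_2,\dots)$ and let $\gamma_*$ be defined from this expansion as in the context. Then $$M(\alpha,\gamma_* )\ \ge\ \frac{(\sqrt{10}-3)(7-\sqrt{13})}{31-2\sqrt{10}-3\sqrt{13}}=\frac{1}{25.159\ldots}.$$
   Context: For real $x$, $\|x\|$ is the distance to the nearest integer. $M(\alpha,\gamma):=\liminf_{|n|\to\infty}|n|\,\|n\alpha-\gamma\|$ ($n\in\mathbb Z$). A semi-regular expansion of $\alpha$ is $\alpha=a_0+\cfrac{\varepsilon_1}{a_1+\cfrac{\varepsilon_2}{a_2+\cdots}}$ with $a_0\in\mathbb Z$, integers $a_i\ge1$ ($i\ge1$), $\varepsilon_i\in\{\pm1\}$. Write $\alpha_i:=\cfrac{1}{a_{i+1}+\cfrac{\varepsilon_{i+2}}{a_{i+2}+\cdots}}$ and, for $i\ge1$, $\bar\alpha_i:=\cfrac{1}{a_i+\cfrac{\varepsilon_i}{a_{i-1}+\cfrac{\varepsilon_{i-1}}{\ddots+\cfrac{\varepsilon_2}{a_1}}}}$. It is an adjusted nearest integer expansion if: (i) $a_i\ge2$ for all $i\ge1$, and $a_i=2$ implies $\varepsilon_i=1$ or $\varepsilon_{i+1}=1$; (ii) if $a_i=2$ and $\varepsilon_i=-1$ then $1/\bar\alpha_{i-1}-1/\alpha_i\ge1$; (iii) if $a_i=2$ and $\varepsilon_{i+1}=-1$ then $1/\alpha_i-1/\bar\alpha_{i-1}>1$; (iv) the sequence $(\varepsilon_ia_i)$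 contains no consecutive block $2,-2$ and no consecutive block $2,-3,-3,\dots,-3,-2$ (with $k\ge1$ entries $-3$). Convergents: $p_{-1}=1,q_{-1}=0,p_0=a_0,q_0=1$, $p_i=a_ip_{i-1}+\varepsilon_ip_{i-2}$, $q_i=a_iq_{i-1}+\varepsilon_iq_{i-2}$; $D_i:=|q_i\alpha-p_i|$. Let $\lambda_i=0$ if $a_i$ is even and $\lambda_i=(-1)^j$ if $a_i$ is the $j$-th odd term among $a_1,a_2,\dots$. Set $\gamma_*:=\sum_{i\ge1}\tfrac12(a_i-1+\varepsilon_i+\lambda_i)D_{i-1}$. *)

theory Defs
  imports "HOL-Analysis.Analysis"
begin

definition nearest_int_dist :: "real \<Rightarrow> real" where
  "nearest_int_dist x = \<bar>x - of_int (round x)\<bar>"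

definition inhom_const :: "real \<Rightarrow> real \<Rightarrow> ereal" where
  "inhom_const \<alpha> \<gamma> =
     Liminf (filtercomap (\<lambda>n::int. \<bar>n\<bar>) at_top)
       (\<lambda>n::int. ereal (of_int \<bar>n\<bar> * nearest_int_dist (of_int n * \<alpha> - \<gamma>)))"

text \<open>An expansion \<open>(a\<^sub>0; \<epsilon>\<^sub>1 a\<^sub>1, \<epsilon>\<^sub>2 a\<^sub>2, \<dots>)\<close> is given by the two sequences \<open>a\<close> and \<open>\<epsilon>\<close>; the value
  \<open>\<epsilon> 0\<close> is never used. The convergents start at index 0; the values \<open>p\<^sub>-\<^sub>1 = 1\<close> and \<open>q\<^sub>-\<^sub>1 = 0\<close> are
  built into the equations for index 1.\<close>

fun cf_p :: "(nat \<Rightarrow> int) \<Rightarrow> (nat \<Rightarrow> int) \<Rightarrow> nat \<Rightarrow> int" where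
  "cf_p a \<epsilon> 0 = a 0"
| "cf_p a \<epsilon> (Suc 0) = a 1 * a 0 + \<epsilon> 1 * 1"
| "cf_p a \<epsilon> (Suc (Suc i)) =
     a (Suc (Suc i)) * cf_p a \<epsilon> (Suc i) + \<epsilon> (Suc (Suc i)) * cf_p a \<epsilon> i"

fun cf_q :: "(nat \<Rightarrow> int) \<Rightarrow> (nat \<Rightarrow> int) \<Rightarrow> nat \<Rightarrow> int" where
  "cf_q a \<epsilon> 0 = 1"
| "cf_q a \<epsilon> (Suc 0) = a 1 * 1 + \<epsilon> 1 * 0"
| "cf_q a \<epsilon> (Suc (Suc i)) =
     a (Suc (Suc i)) * cf_q a \<epsilon> (Suc i) + \<epsilon> (Suc (Suc i)) * cf_q a \<epsilon> i"

definition cf_convergent :: "(nat \<Rightarrow> int) \<Rightarrow> (nat \<Rightarrow> int) \<Rightarrow> nat \<Rightarrow> real" where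
  "cf_convergent a \<epsilon> i = of_int (cf_p a \<epsilon> i) / of_int (cf_q a \<epsilon> i)"

definition semi_regular_expansion :: "real \<Rightarrow> (nat \<Rightarrow> int) \<Rightarrow> (nat \<Rightarrow> int) \<Rightarrow> bool" where
  "semi_regular_expansion \<alpha> a \<epsilon> \<longleftrightarrow>
     (\<forall>i\<ge>1. a i \<ge> 1 \<and> \<epsilon> i \<in> {1, -1}) \<and> cf_convergent a \<epsilon> \<longlonglongrightarrow> \<alpha>"

text \<open>\<open>\<alpha>\<^sub>i\<close> is the reciprocal of the value of the expansion \<open>(a\<^sub>i\<^sub>+\<^sub>1; \<epsilon>\<^sub>i\<^sub>+\<^sub>2 a\<^sub>i\<^sub>+\<^sub>2, \<dots>)\<close>.\<close>

definition cf_tail :: "(nat \<Rightarrow> int) \<Rightarrow> (nat \<Rightarrow> int) \<Rightarrow> nat \<Rightarrow> real" where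
  "cf_tail a \<epsilon> i = 1 / lim (cf_convergent (\<lambda>j. a (i + 1 + j)) (\<lambda>j. \<epsilon> (i + 1 + j)))"

text \<open>\<open>\<alpha>\<close>-bar, defined for indices \<open>\<ge> 1\<close>; the value 0 at index 0 only serves to start the
  recursion, so that the value at index 1 is \<open>1 / a\<^sub>1\<close>.\<close>

primrec cf_bar :: "(nat \<Rightarrow> int) \<Rightarrow> (nat \<Rightarrow> int) \<Rightarrow> nat \<Rightarrow> real" where
  "cf_bar a \<epsilon> 0 = 0"
| "cf_bar a \<epsilon> (Suc i) = 1 / (of_int (a (Suc i)) + of_int (\<epsilon> (Suc i)) * cf_bar a \<epsilon> i)"

text \<open>The second and third conditions mention \<open>\<alpha>\<close>-bar at index \<open>i - 1\<close>, hence \<open>i \<ge> 2\<close> there.\<close>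

definition adjusted_nearest_integer_expansion ::
    "real \<Rightarrow> (nat \<Rightarrow> int) \<Rightarrow> (nat \<Rightarrow> int) \<Rightarrow> bool" where
  "adjusted_nearest_integer_expansion \<alpha> a \<epsilon> \<longleftrightarrow>
     semi_regular_expansion \<alpha> a \<epsilon> \<and>
     (\<forall>i\<ge>1. a i \<ge> 2 \<and> (a i = 2 \<longrightarrow> \<epsilon> i = 1 \<or> \<epsilon> (i + 1) = 1)) \<and>
     (\<forall>i\<ge>2. a i = 2 \<and> \<epsilon> i = -1 \<longrightarrow> 1 / cf_bar a \<epsilon> (i - 1) - 1 / cf_tail a \<epsilon> i \<ge> 1) \<and>
     (\<forall>i\<ge>2. a i = 2 \<and> \<epsilon> (i + 1) = -1 \<longrightarrow> 1 / cf_tail a \<epsilon> i - 1 / cf_bar a \<epsilon> (i - 1) > 1) \<and>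
     \<not> (\<exists>i\<ge>1. \<epsilon> i * a i = 2 \<and> \<epsilon> (i + 1) * a (i + 1) = -2) \<and>
     \<not> (\<exists>i\<ge>1. \<exists>k\<ge>1. \<epsilon> i * a i = 2 \<and> (\<forall>j\<in>{1..k}. \<epsilon> (i + j) * a (i + j) = -3) \<and>
          \<epsilon> (i + k + 1) * a (i + k + 1) = -2)"

definition cf_D :: "real \<Rightarrow> (nat \<Rightarrow> int) \<Rightarrow> (nat \<Rightarrow> int) \<Rightarrow> nat \<Rightarrow> real" where
  "cf_D \<alpha> a \<epsilon> i = \<bar>of_int (cf_q a \<epsilon> i) * \<alpha> - of_int (cf_p a \<epsilon> i)\<bar>"

definition odd_sign :: "(nat \<Rightarrow> int) \<Rightarrow> nat \<Rightarrow> int" where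
  "odd_sign a i = (if even (a i) then 0 else (-1) ^ card {j \<in> {1..i}. odd (a j)})"

text \<open>The summation index is shifted by one: the \<open>i\<close>-th summand below is the one for \<open>i + 1\<close>.\<close>

definition gamma_star :: "real \<Rightarrow> (nat \<Rightarrow> int) \<Rightarrow> (nat \<Rightarrow> int) \<Rightarrow> real" where
  "gamma_star \<alpha> a \<epsilon> =
     (\<Sum>i. 1 / 2 * of_int (a (Suc i) - 1 + \<epsilon> (Suc i) + odd_sign a (Suc i)) * cf_D \<alpha> a \<epsilon> i)"

end

theory Submission
  imports Defs
begin

text \<open>For each \<open>k\<close> the convergents \<open>k - 1\<close> and \<open>k\<close> give a basis of the lattice \<open>{(n, n \<alpha> - m)}\<close>, and \<open>\<gamma>\<^sub>*\<close>
  is chosen so that the grid \<open>{(n, n \<alpha> - m - \<gamma>\<^sub>*)}\<close> has, up to small errors, a fundamental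
  parallelogram in this basis with one vertex in each quadrant. A grid point is considered at the
  first \<open>k\<close> where its coordinate along the vector of the \<open>k\<close>-th convergent no longer exceeds the one
  along the vector of the previous convergent: if it is not a vertex there, its product \<open>|x y|\<close>
  is bounded away from the critical value by crude estimates. For the vertices the four products are rational functions of \<open>\<alpha>\<^sub>k\<close>, \<open>\<alpha>\<close>-bar\<open>\<^sub>k\<close> and of the
  normalised sums \<open>t\<close> and \<open>s\<close> of the \<open>\<lambda>\<^sub>i\<close> to the right and left of \<open>k\<close>. All are comfortably large,
  except around a block \<open>-2, 2, -3, -\<close>. There the minimum separates: the right side is extremal for
  the periodic tail \<open>4, -2, 2, 2, -4, -2, 2, 2, \<dots>\<close> (giving \<open>sqrt 10\<close>), by a contraction argument, and
  the left side for \<open>\<dots>, 3, 3, 3\<close> (giving \<open>sqrt 13\<close>), by induction along the partial quotients.\<close>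

section \<open>Convergence of the tails\<close>

text \<open>By \<open>determinant\<close>, the scaled product at a vertex is, up to an error of
  order \<open>P k\<close>, a left factor in \<open>z k\<close>, \<open>s k\<close> times a right
  factor in \<open>x k\<close>, \<open>t k\<close>, divided by 1 + eps * x * z. The two sides are
  not independent: conditions (ii) and (iii) compare a tail with a reversed tail, so a bad right
  side puts demands on the left one. In the worst case (iii) forces the quotient -2 on the left, and
  (iv) excludes a -2 right after the -3. Once the forced quotients are divided out, the right side
  enters monotonically through x - t and t; at its extreme value an inequality linear in z and s is
  left, and a linear functional can be propagated step by step to the left. The left recursion has a
  beginning and allows induction. The right one has none, which is why the bounds on
  \<open>t\<close> and on x - t start from a crude a priori bound and iterate a contraction.
  \<open>kappa\<close> is the critical quotient at the two fixed points.\<close>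

lemma cf_q_Suc_shift:
  "cf_q a \<epsilon> (Suc n) = cf_p (\<lambda>j. a (Suc j)) (\<lambda>j. \<epsilon> (Suc j)) n"
  by (induction n rule: induct_nat_012) auto

text \<open>Together with \<open>cf_q_Suc_shift\<close> this peels off the first quotient, p/q = a 0
  + eps 1 / (p'/q'), whereas the defining recursions append a last one.\<close>

lemma cf_p_Suc_shift:
  "cf_p a \<epsilon> (Suc n) = a 0 * cf_p (\<lambda>j. a (Suc j)) (\<lambda>j. \<epsilon> (Suc j)) n
     + \<epsilon> 1 * cf_q (\<lambda>j. a (Suc j)) (\<lambda>j. \<epsilon> (Suc j)) n"
  by (induction n rule: induct_nat_012) (auto simp: algebra_simps)

text \<open>With quotients at least 2 the increments of q never shrink, even if all signs are
  negative.\<close>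

lemma cf_q_increasing:
  assumes "\<And>i. i \<ge> 1 \<Longrightarrow> a i \<ge> 2 \<and> \<bar>\<epsilon> i\<bar> = (1::int)"
  shows "cf_q a \<epsilon> n \<ge> 1 \<and> cf_q a \<epsilon> (Suc n) \<ge> cf_q a \<epsilon> n + 1"
proof (induction n)
  case 0
  then show ?case using assms[of 1] by auto
next
  case (Suc n)
  let ?i = "Suc (Suc n)"
  have "a ?i * cf_q a \<epsilon> (Suc n) \<ge> 2 * cf_q a \<epsilon> (Suc n)"
    using assms[of ?i] Suc by (intro mult_right_mono) auto
  moreover have "\<epsilon> ?i * cf_q a \<epsilon> n \<ge> - cf_q a \<epsilon> n"
    using assms[of ?i] Suc by (cases "\<epsilon> ?i = 1") (auto simp: abs_if split: if_splits)
  ultimately have "cf_q a \<epsilon> ?i \<ge> 2 * cf_q a \<epsilon> (Suc n) - cf_q a \<epsilon> n"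
    by simp
  then show ?case using Suc by linarith
qed

text \<open>The differences p - q obey the same recursion, so their increments do not become
  negative either. In the limit this keeps the tails above 1.\<close>

lemma cf_q_le_cf_p:
  assumes "\<And>i. i \<ge> 1 \<Longrightarrow> a i \<ge> 2 \<and> \<bar>\<epsilon> i\<bar> = (1::int)" "a 0 \<ge> 2"
  shows "cf_p a \<epsilon> n \<ge> cf_q a \<epsilon> n + 1 \<and>
    cf_p a \<epsilon> (Suc n) - cf_q a \<epsilon> (Suc n) \<ge> cf_p a \<epsilon> n - cf_q a \<epsilon> n"
proof (induction n)
  case 0
  have "a 1 * (a 0 - 1) \<ge> 2 * (a 0 - 1)"
    using assms(1)[of 1] assms(2) by (intro mult_right_mono) auto
  then show ?case using assms(1)[of 1] assms(2) by (auto simp: algebra_simps)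
next
  case (Suc n)
  let ?i = "Suc (Suc n)"
  define r where "r n = cf_p a \<epsilon> n - cf_q a \<epsilon> n" for n
  have "a ?i * r (Suc n) \<ge> 2 * r (Suc n)"
    using assms(1)[of ?i] Suc unfolding r_def by (intro mult_right_mono) auto
  moreover have "\<epsilon> ?i * r n \<ge> - r n"
    using assms(1)[of ?i] Suc unfolding r_def by (cases "\<epsilon> ?i = 1") (auto simp: abs_if split: if_splits)
  moreover have "r ?i = a ?i * r (Suc n) + \<epsilon> ?i * r n"
    by (simp add: r_def algebra_simps)
  ultimately have "r ?i \<ge> r (Suc n)" using Suc unfolding r_def[symmetric] by linarith
  then show ?case using Suc unfolding r_def by linarith
qed

text \<open>Irrationality of \<open>l\<close> keeps the denominator of the limit away from 0, and it
  is inherited by the tail, so the step can be repeated.\<close>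

lemma cf_convergent_shift:
  assumes reg: "\<And>i. i \<ge> 1 \<Longrightarrow> a i \<ge> 2 \<and> \<bar>\<epsilon> i\<bar> = (1::int)"
    and lim: "cf_convergent a \<epsilon> \<longlonglongrightarrow> l" and irr: "l \<notin> \<rat>"
  shows "cf_convergent (\<lambda>j. a (Suc j)) (\<lambda>j. \<epsilon> (Suc j)) \<longlonglongrightarrow> of_int (\<epsilon> 1) / (l - of_int (a 0))"
    and "of_int (\<epsilon> 1) / (l - of_int (a 0)) \<notin> \<rat>"
proof -
  let ?a = "\<lambda>j. a (Suc j)" and ?e = "\<lambda>j. \<epsilon> (Suc j)"
  have eps: "\<epsilon> 1 = 1 \<or> \<epsilon> 1 = -1" using reg[of 1] by auto
  have ne: "l - of_int (a 0) \<noteq> 0" using irr by (metis Rats_of_int eq_iff_diff_eq_0)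
  have "cf_convergent ?a ?e n = of_int (\<epsilon> 1) / (cf_convergent a \<epsilon> (Suc n) - of_int (a 0))" for n
  proof -
    have "cf_p ?a ?e n \<ge> 1"
      using cf_q_increasing[of a \<epsilon> "Suc n"] reg by (simp add: cf_q_Suc_shift)
    then have "cf_convergent a \<epsilon> (Suc n) - of_int (a 0)
        = of_int (\<epsilon> 1) * of_int (cf_q ?a ?e n) / of_int (cf_p ?a ?e n)"
      unfolding cf_convergent_def cf_q_Suc_shift cf_p_Suc_shift by (simp add: field_simps)
    then show ?thesis unfolding cf_convergent_def using eps by auto
  qed
  then have "cf_convergent ?a ?e
      = (\<lambda>n. of_int (\<epsilon> 1) / (cf_convergent a \<epsilon> (Suc n) - of_int (a 0)))"
    by blast
  moreover have "(\<lambda>n. of_int (\<epsilon> 1) / (cf_convergent a \<epsilon> (Suc n) - of_int (a 0)))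
      \<longlonglongrightarrow> of_int (\<epsilon> 1) / (l - of_int (a 0))"
    by (intro tendsto_intros LIMSEQ_Suc lim ne)
  ultimately show "cf_convergent ?a ?e \<longlonglongrightarrow> of_int (\<epsilon> 1) / (l - of_int (a 0))"
    by simp
  show "of_int (\<epsilon> 1) / (l - of_int (a 0)) \<notin> \<rat>"
  proof
    assume *: "of_int (\<epsilon> 1) / (l - of_int (a 0)) \<in> \<rat>"
    have eq: "l = of_int (a 0) + of_int (\<epsilon> 1) / (of_int (\<epsilon> 1) / (l - of_int (a 0)))"
      using eps ne by auto
    have "of_int (a 0) + of_int (\<epsilon> 1) / (of_int (\<epsilon> 1) / (l - of_int (a 0))) \<in> \<rat>"
      by (intro Rats_add Rats_divide[OF _ *] Rats_of_int)
    then show False using irr eq by metis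
  qed
qed

locale adjusted_expansion =
  fixes \<alpha> :: real and a \<epsilon> :: "nat \<Rightarrow> int"
  assumes irrational: "\<alpha> \<notin> \<rat>"
    and expansion: "adjusted_nearest_integer_expansion \<alpha> a \<epsilon>"
begin

abbreviation x :: "nat \<Rightarrow> real" where "x \<equiv> cf_tail a \<epsilon>"
abbreviation z :: "nat \<Rightarrow> real" where "z \<equiv> cf_bar a \<epsilon>"

lemma a_ge_2: "i \<ge> 1 \<Longrightarrow> a i \<ge> 2"
  using expansion by (auto simp: adjusted_nearest_integer_expansion_def)

lemma eps_cases: "i \<ge> 1 \<Longrightarrow> \<epsilon> i = 1 \<or> \<epsilon> i = -1"
  using expansion by (auto simp: adjusted_nearest_integer_expansion_def semi_regular_expansion_def)

lemma eps_around_2: "i \<ge> 1 \<Longrightarrow> a i = 2 \<Longrightarrow> \<epsilon> i = -1 \<Longrightarrow> \<epsilon> (Suc i) = 1"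
  using expansion by (auto simp: adjusted_nearest_integer_expansion_def)

lemma bar_tail_ge: "i \<ge> 1 \<Longrightarrow> a (Suc i) = 2 \<Longrightarrow> \<epsilon> (Suc i) = -1 \<Longrightarrow> 1 / z i - 1 / x (Suc i) \<ge> 1"
  using expansion unfolding adjusted_nearest_integer_expansion_def
  by (metis Suc_le_mono One_nat_def diff_Suc_1 numeral_2_eq_2)

lemma tail_bar_gt: "i \<ge> 1 \<Longrightarrow> a (Suc i) = 2 \<Longrightarrow> \<epsilon> (Suc (Suc i)) = -1 \<Longrightarrow> 1 / x (Suc i) - 1 / z i > 1"
  using expansion unfolding adjusted_nearest_integer_expansion_def
  by (metis Suc_le_mono One_nat_def diff_Suc_1 numeral_2_eq_2 Suc_eq_plus1)

lemma no_block_2_2: "i \<ge> 1 \<Longrightarrow> a i = 2 \<Longrightarrow> \<epsilon> i = 1 \<Longrightarrow> \<epsilon> (Suc i) = -1 \<Longrightarrow> a (Suc i) \<ge> 3"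
proof (rule ccontr)
  assume *: "i \<ge> 1" "a i = 2" "\<epsilon> i = 1" "\<epsilon> (Suc i) = -1" "\<not> a (Suc i) \<ge> 3"
  then have "a (Suc i) = 2" using a_ge_2[of "Suc i"] by simp
  then have "\<epsilon> i * a i = 2 \<and> \<epsilon> (i + 1) * a (i + 1) = -2" using * by simp
  then show False using expansion \<open>i \<ge> 1\<close> unfolding adjusted_nearest_integer_expansion_def by blast
qed

lemma no_block_2_3_2:
  assumes "i \<ge> 1" "a i = 2" "\<epsilon> i = 1" "\<epsilon> (Suc i) = -1" "a (Suc i) = 3" "\<epsilon> (Suc (Suc i)) = -1"
  shows "a (Suc (Suc i)) \<ge> 3"
proof (rule ccontr)
  assume *: "\<not> a (Suc (Suc i)) \<ge> 3"
  then have "a (Suc (Suc i)) = 2" using a_ge_2[of "Suc (Suc i)"] by simp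
  then have "\<exists>i\<ge>1. \<exists>k\<ge>1. \<epsilon> i * a i = 2 \<and> (\<forall>j\<in>{1..k}. \<epsilon> (i + j) * a (i + j) = -3) \<and>
          \<epsilon> (i + k + 1) * a (i + k + 1) = -2"
    using assms by (intro exI[of _ i] conjI exI[of _ 1]) auto
  then show False using expansion unfolding adjusted_nearest_integer_expansion_def by blast
qed

text \<open>\<open>cf_tail\<close> is built on \<open>lim\<close>, which carries information only
  for convergent sequences; convergence of every shifted expansion is derived here from that of the
  given one.\<close>

lemma tail_limit:
  "\<exists>l. l \<notin> \<rat> \<and> cf_convergent (\<lambda>j. a (i + j)) (\<lambda>j. \<epsilon> (i + j)) \<longlonglongrightarrow> l"
proof (induction i)
  case 0
  then show ?case using irrational expansion
    by (auto simp: adjusted_nearest_integer_expansion_def semi_regular_expansion_def)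
next
  case (Suc i)
  then obtain l where l: "l \<notin> \<rat>" "cf_convergent (\<lambda>j. a (i + j)) (\<lambda>j. \<epsilon> (i + j)) \<longlonglongrightarrow> l"
    by blast
  have reg: "a (i + j) \<ge> 2 \<and> \<bar>\<epsilon> (i + j)\<bar> = (1::int)" if "j \<ge> 1" for j
    using a_ge_2[of "i + j"] eps_cases[of "i + j"] that by auto
  show ?case
    using cf_convergent_shift[of "\<lambda>j. a (i + j)" "\<lambda>j. \<epsilon> (i + j)", OF reg l(2,1)] by auto
qed

lemma lim_rec:
  fixes T defines "T \<equiv> \<lambda>i. lim (cf_convergent (\<lambda>j. a (i + j)) (\<lambda>j. \<epsilon> (i + j)))"
  shows "T i = of_int (a i) + of_int (\<epsilon> (Suc i)) / T (Suc i)" "T i \<notin> \<rat>" "i \<ge> 1 \<Longrightarrow> T i > 1"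
proof -
  have T: "T i \<notin> \<rat> \<and> cf_convergent (\<lambda>j. a (i + j)) (\<lambda>j. \<epsilon> (i + j)) \<longlonglongrightarrow> T i" for i
    using tail_limit[of i] limI unfolding T_def by metis
  have reg: "a (i + j) \<ge> 2 \<and> \<bar>\<epsilon> (i + j)\<bar> = (1::int)" if "j \<ge> 1" for j
    using a_ge_2[of "i + j"] eps_cases[of "i + j"] that by auto
  have "cf_convergent (\<lambda>j. a (Suc i + j)) (\<lambda>j. \<epsilon> (Suc i + j))
      \<longlonglongrightarrow> of_int (\<epsilon> (Suc i)) / (T i - of_int (a i))"
    using cf_convergent_shift(1)[of "\<lambda>j. a (i + j)" "\<lambda>j. \<epsilon> (i + j)" "T i", OF reg] T by auto
  then have "T (Suc i) = of_int (\<epsilon> (Suc i)) / (T i - of_int (a i))"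
    using T[of "Suc i"] LIMSEQ_unique by blast
  moreover have "\<epsilon> (Suc i) \<noteq> 0" using eps_cases[of "Suc i"] by auto
  moreover have "T i - of_int (a i) \<noteq> 0"
    using T[of i] by (metis Rats_of_int eq_iff_diff_eq_0)
  ultimately show "T i = of_int (a i) + of_int (\<epsilon> (Suc i)) / T (Suc i)" by simp
  show "T i \<notin> \<rat>" using T by blast
  assume i: "i \<ge> 1"
  let ?a = "\<lambda>j. a (i + j)" and ?e = "\<lambda>j. \<epsilon> (i + j)"
  have "cf_convergent ?a ?e n \<ge> 1" for n
    using cf_q_le_cf_p[of ?a ?e n, OF reg] cf_q_increasing[of ?a ?e n, OF reg] a_ge_2[of i] i
    unfolding cf_convergent_def by simp
  then have "T i \<ge> 1" using T[of i] by (intro LIMSEQ_le_const[of "cf_convergent ?a ?e"]) auto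
  moreover have "T i \<noteq> 1" using T[of i] by auto
  ultimately show "T i > 1" by simp
qed

lemma x_pos: "x i > 0" and x_less_1: "x i < 1"
  and x_rec: "x i * (of_int (a (Suc i)) + of_int (\<epsilon> (Suc (Suc i))) * x (Suc i)) = 1"
  and alpha_eq: "\<alpha> = of_int (a 0) + of_int (\<epsilon> 1) * x 0"
proof -
  have *: "lim (cf_convergent (\<lambda>j. a (Suc i + j)) (\<lambda>j. \<epsilon> (Suc i + j))) > 1" for i
    using lim_rec(3)[of "Suc i"] by simp
  show "x i > 0" "x i < 1" for i using *[of i] by (auto simp: cf_tail_def)
  show "x i * (of_int (a (Suc i)) + of_int (\<epsilon> (Suc (Suc i))) * x (Suc i)) = 1"
    using *[of i] lim_rec(1)[of "Suc i"] by (simp add: cf_tail_def)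
  have "lim (cf_convergent a \<epsilon>) = \<alpha>"
    using expansion by (auto simp: adjusted_nearest_integer_expansion_def semi_regular_expansion_def limI)
  then show "\<alpha> = of_int (a 0) + of_int (\<epsilon> 1) * x 0"
    using lim_rec(1)[of 0] by (simp add: cf_tail_def)
qed

end

section \<open>Bounds on tails and reversed tails\<close>

lemma divide_bounds:
  fixes d :: real
  assumes "0 < d" "l * d \<le> n" "n \<le> u * d"
  shows "l \<le> n / d \<and> n / d \<le> u"
  using assms by (simp add: pos_le_divide_eq pos_divide_le_eq)

text \<open>The interval [-1/4, 1/2] is invariant under both steps of the recursion for
  \<open>s\<close>. It is tight for these estimates: (1 + 1/2)/3 and (1 + 1/4)/(3 - 1/2) both equal
  1/2, and an even step gives -(1/2)/2.\<close>

lemma s_step_odd: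
  fixes A e s z :: real
  assumes "e = 1 \<or> e = -1 \<and> z \<le> 1 / 2" "A \<ge> 3" "- 1 / 4 \<le> s" "s \<le> 1 / 2" "0 \<le> z"
  shows "- 1 / 4 \<le> (1 + e * s) / (A + e * z) \<and> (1 + e * s) / (A + e * z) \<le> 1 / 2"
  using assms by (intro divide_bounds) (auto simp: field_simps)

lemma s_step_even:
  fixes A e s z :: real
  assumes "e = 1 \<or> e = -1 \<and> z \<le> 1 / 2" "A \<ge> 2" "- 1 / 4 \<le> s" "s \<le> 1 / 2" "0 \<le> z"
  shows "- 1 / 4 \<le> (- e * s) / (A + e * z) \<and> (- e * s) / (A + e * z) \<le> 1 / 2"
  using assms by (intro divide_bounds) (auto simp: field_simps)

context adjusted_expansion
begin

lemma x_eq: "x i = 1 / (of_int (a (Suc i)) + of_int (\<epsilon> (Suc (Suc i))) * x (Suc i))"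
  using x_rec[of i] by (metis nonzero_eq_divide_eq mult_zero_right zero_neq_one)

lemma x_plus: "\<epsilon> (Suc (Suc i)) = 1 \<Longrightarrow> x i = 1 / (of_int (a (Suc i)) + x (Suc i))"
  and x_minus: "\<epsilon> (Suc (Suc i)) = -1 \<Longrightarrow> x i = 1 / (of_int (a (Suc i)) - x (Suc i))"
  by (subst x_eq; simp)+

text \<open>After a minus sign the denominator is at least 2: condition (i) forces a plus behind a
  quotient 2, and a larger quotient leaves room to subtract a tail below 1.\<close>

lemma x_le_half: "\<epsilon> (Suc i) = -1 \<Longrightarrow> x i \<le> 1 / 2"
proof -
  assume e: "\<epsilon> (Suc i) = -1"
  have "of_int (a (Suc i)) + of_int (\<epsilon> (Suc (Suc i))) * x (Suc i) \<ge> (2::real)"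
  proof (cases "a (Suc i) = 2")
    case True
    then show ?thesis using eps_around_2[of "Suc i"] e x_pos[of "Suc i"] by simp
  next
    case False
    then have "real_of_int (a (Suc i)) \<ge> 3" using a_ge_2[of "Suc i"] by simp
    then show ?thesis using eps_cases[of "Suc (Suc i)"] x_pos[of "Suc i"] x_less_1[of "Suc i"] by auto
  qed
  then show ?thesis by (subst x_eq) (simp add: field_simps)
qed

lemma x_denominator_ge:
  assumes "of_int c \<le> a (Suc i)"
  shows "of_int (a (Suc i)) + of_int (\<epsilon> (Suc (Suc i))) * x (Suc i) \<ge> real_of_int c - 1 / 2"
proof -
  have "real_of_int (a (Suc i)) \<ge> real_of_int c" using assms by simp
  then show ?thesis
    using x_le_half[of "Suc i"] eps_cases[of "Suc (Suc i)"] x_pos[of "Suc i"] by auto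
qed

lemma x_le:
  assumes "c \<le> a (Suc i)" "c \<ge> 2"
  shows "x i \<le> 2 / (2 * of_int c - 1)"
proof -
  have "x i \<le> 1 / (real_of_int c - 1 / 2)"
    using x_denominator_ge[of c i] assms by (subst x_eq, intro divide_left_mono) (auto intro: mult_pos_pos)
  also have "\<dots> = 2 / (2 * of_int c - 1)" using assms by (simp add: field_simps)
  finally show ?thesis .
qed

lemma x_le_2_3: "x i \<le> 2 / 3"
  using x_le[of 2 i] a_ge_2[of "Suc i"] by simp

lemma x_le_2_5: "a (Suc i) \<ge> 3 \<Longrightarrow> x i \<le> 2 / 5"
  using x_le[of 3 i] by simp

lemma x_le_2_7: "a (Suc i) \<ge> 4 \<Longrightarrow> x i \<le> 2 / 7"
  using x_le[of 4 i] by simp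

lemma x_le_2_9: "a (Suc i) \<ge> 5 \<Longrightarrow> x i \<le> 2 / 9"
  using x_le[of 5 i] by simp

lemma x_le_inverse: "\<epsilon> (Suc (Suc i)) = 1 \<Longrightarrow> x i \<le> 1 / of_int (a (Suc i))"
  using x_plus[of i] a_ge_2[of "Suc i"] x_pos[of "Suc i"] by (simp add: frac_le)

lemma x_ge_inverse: "\<epsilon> (Suc (Suc i)) = -1 \<Longrightarrow> x i \<ge> 1 / of_int (a (Suc i))"
  using x_minus[of i] a_ge_2[of "Suc i"] x_pos[of "Suc i"] x_less_1[of "Suc i"] by (simp add: frac_le)

lemma x_ge_3_8: "a (Suc i) = 2 \<Longrightarrow> x i \<ge> 3 / 8"
proof -
  assume a: "a (Suc i) = 2"
  have "real_of_int (\<epsilon> (Suc (Suc i))) * x (Suc i) \<le> 2 / 3"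
    using eps_cases[of "Suc (Suc i)"] x_le_2_3[of "Suc i"] x_pos[of "Suc i"] by auto
  moreover have "real_of_int (\<epsilon> (Suc (Suc i))) * x (Suc i) > - 1"
    using eps_cases[of "Suc (Suc i)"] x_less_1[of "Suc i"] x_pos[of "Suc i"] by auto
  ultimately show ?thesis using a by (subst x_eq) (simp add: field_simps)
qed

lemma z_Suc: "z (Suc i) = 1 / (of_int (a (Suc i)) + of_int (\<epsilon> (Suc i)) * z i)"
  by simp

declare cf_bar.simps(2) [simp del]

lemma z_plus: "\<epsilon> (Suc i) = 1 \<Longrightarrow> z (Suc i) = 1 / (of_int (a (Suc i)) + z i)"
  and z_minus: "\<epsilon> (Suc i) = -1 \<Longrightarrow> z (Suc i) = 1 / (of_int (a (Suc i)) - z i)"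
  by (subst z_Suc; simp)+

text \<open>The bounds are proved together: the bound 1/2 in front of a minus sign is what keeps the
  next denominator at least 3/2, and condition (i) reproduces the 1/2.\<close>

lemma z_bounds: "0 \<le> z i \<and> z i \<le> 2 / 3 \<and> (\<epsilon> (Suc i) = -1 \<longrightarrow> z i \<le> 1 / 2)"
proof (induction i)
  case 0
  then show ?case by simp
next
  case (Suc i)
  let ?d = "of_int (a (Suc i)) + of_int (\<epsilon> (Suc i)) * z i"
  have a: "a (Suc i) = 2 \<or> a (Suc i) \<ge> 3" using a_ge_2[of "Suc i"] by linarith
  have "?d \<ge> 3 / 2"
    using a eps_cases[of "Suc i"] Suc a_ge_2[of "Suc i"] by auto
  moreover have "?d \<ge> 2" if "\<epsilon> (Suc (Suc i)) = -1"
    using a eps_cases[of "Suc i"] Suc eps_around_2[of "Suc i"] that by auto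
  ultimately show ?case unfolding z_Suc by (simp add: field_simps)
qed

lemmas z_nonneg = z_bounds[THEN conjunct1]
  and z_le_2_3 = z_bounds[THEN conjunct2, THEN conjunct1]
  and z_le_half = z_bounds[THEN conjunct2, THEN conjunct2, rule_format]

lemma z_denominator_ge:
  assumes "c \<le> a (Suc i)"
  shows "of_int (a (Suc i)) + of_int (\<epsilon> (Suc i)) * z i \<ge> real_of_int c - 1 / 2"
proof -
  have "real_of_int (a (Suc i)) \<ge> real_of_int c" using assms by simp
  then show ?thesis
    using z_le_half[of i] eps_cases[of "Suc i"] z_nonneg[of i] by auto
qed

lemma z_pos: "z (Suc i) > 0"
  using z_denominator_ge[of 2 i] a_ge_2[of "Suc i"] unfolding z_Suc by simp

lemma z_le_inverse: "\<epsilon> (Suc i) = 1 \<Longrightarrow> z (Suc i) \<le> 1 / of_int (a (Suc i))"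
  using z_plus[of i] a_ge_2[of "Suc i"] z_nonneg[of i] by (simp add: frac_le)

lemma z_ge_3_8: "a (Suc i) = 2 \<Longrightarrow> z (Suc i) \<ge> 3 / 8"
proof -
  assume a: "a (Suc i) = 2"
  have "real_of_int (\<epsilon> (Suc i)) * z i \<le> 2 / 3" "real_of_int (\<epsilon> (Suc i)) * z i \<ge> - 1"
    using eps_cases[of "Suc i"] z_le_2_3[of i] z_nonneg[of i] by auto
  then show ?thesis using a unfolding z_Suc by (simp add: field_simps)
qed

lemma z_le:
  assumes "c \<le> a (Suc i)" "c \<ge> 2"
  shows "z (Suc i) \<le> 2 / (2 * of_int c - 1)"
proof -
  have "z (Suc i) \<le> 1 / (real_of_int c - 1 / 2)"
    using z_denominator_ge[of c i] assms unfolding z_Suc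
    by (intro divide_left_mono) (auto intro: mult_pos_pos)
  also have "\<dots> = 2 / (2 * of_int c - 1)" using assms by (simp add: field_simps)
  finally show ?thesis .
qed

text \<open>Up to the sign \<open>nu\<close>, \<open>s k\<close> is \<open>(\<Sum>i\<le>k. \<plusminus> \<lambda>\<^sub>i q\<^sub>i\<^sub>-\<^sub>1) / q\<^sub>k\<close> and \<open>t k\<close> is
  \<open>(\<Sum>i>k. \<lambda>\<^sub>i D\<^sub>i\<^sub>-\<^sub>1) / D\<^sub>k\<^sub>-\<^sub>1\<close>; here \<open>P k = D\<^sub>k\<^sub>-\<^sub>1\<close>, including \<open>D\<^sub>-\<^sub>1 = 1\<close>.\<close>

primrec s :: "nat \<Rightarrow> real" where
  "s 0 = 0"
| "s (Suc i) = (if odd (a (Suc i)) then z (Suc i) * (1 + of_int (\<epsilon> (Suc i)) * s i)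
                else - of_int (\<epsilon> (Suc i)) * s i * z (Suc i))"

definition P :: "nat \<Rightarrow> real" where
  "P k = (\<Prod>i<k. x i)"

definition nu :: "nat \<Rightarrow> int" where
  "nu i = (-1) ^ card {j \<in> {1..i}. odd (a j)}"

definition t :: "nat \<Rightarrow> real" where
  "t k = - of_int (nu k) * (\<Sum>i. of_int (odd_sign a (Suc (i + k))) * P (Suc (i + k))) / P k"

declare s.simps(2) [simp del]

lemma s_odd: "odd (a (Suc i)) \<Longrightarrow> s (Suc i) = z (Suc i) * (1 + of_int (\<epsilon> (Suc i)) * s i)"
  and s_even: "even (a (Suc i)) \<Longrightarrow> s (Suc i) = - of_int (\<epsilon> (Suc i)) * s i * z (Suc i)"
  by (simp_all add: s.simps(2))

lemma s_bounds: "- 1 / 4 \<le> s i \<and> s i \<le> 1 / 2"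
proof (induction i)
  case 0
  then show ?case by simp
next
  case (Suc i)
  have e: "real_of_int (\<epsilon> (Suc i)) = 1 \<or> real_of_int (\<epsilon> (Suc i)) = -1 \<and> z i \<le> 1 / 2"
    using eps_cases[of "Suc i"] z_le_half[of i] by auto
  show ?case
  proof (cases "odd (a (Suc i))")
    case True
    then have "a (Suc i) \<noteq> 2" by auto
    then have "real_of_int (a (Suc i)) \<ge> 3" using a_ge_2[of "Suc i"] by simp
    then show ?thesis
      using s_step_odd[OF e _ _ _ z_nonneg] Suc s_odd[OF True] by (simp add: z_Suc)
  next
    case False
    have "real_of_int (a (Suc i)) \<ge> 2" using a_ge_2[of "Suc i"] by simp
    then show ?thesis
      using s_step_even[OF e _ _ _ z_nonneg] Suc s_even False by (simp add: z_Suc)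
  qed
qed

lemma s_ge: "- 1 / 4 \<le> s i" and s_le: "s i \<le> 1 / 2"
  using s_bounds by auto

lemma P_0 [simp]: "P 0 = 1" and P_Suc: "P (Suc k) = P k * x k" and P_pos: "P k > 0"
  by (auto simp: P_def x_pos prod_pos)

lemma P_rec: "P k = of_int (a (Suc k)) * P (Suc k) + of_int (\<epsilon> (Suc (Suc k))) * P (Suc (Suc k))"
proof -
  have "P k * (x k * (of_int (a (Suc k)) + of_int (\<epsilon> (Suc (Suc k))) * x (Suc k))) = P k"
    using x_rec[of k] by simp
  then show ?thesis by (simp add: P_Suc algebra_simps)
qed

lemma P_add_le: "P (i + k) \<le> P k * (2 / 3) ^ i"
proof (induction i)
  case 0
  then show ?case by simp
next
  case (Suc i)
  have "P (Suc i + k) \<le> (P k * (2 / 3) ^ i) * (2 / 3)"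
    unfolding add_Suc P_Suc using Suc x_le_2_3[of "i + k"] x_pos[of "i + k"] P_pos[of k]
    by (intro mult_mono) auto
  then show ?case by simp
qed

lemma P_tendsto_0: "P \<longlonglongrightarrow> 0"
proof (rule tendsto_sandwich[where f = "\<lambda>_. 0" and h = "\<lambda>i. (2 / 3) ^ i"])
  show "\<forall>\<^sub>F n in sequentially. 0 \<le> P n" using P_pos by (simp add: less_imp_le)
  show "\<forall>\<^sub>F n in sequentially. P n \<le> (2 / 3) ^ n" using P_add_le[of _ 0] by simp
qed (auto intro: LIMSEQ_realpow_zero)

lemma nu_Suc: "nu (Suc i) = (if odd (a (Suc i)) then - nu i else nu i)"
proof -
  have "{j \<in> {1..Suc i}. odd (a j)}
      = {j \<in> {1..i}. odd (a j)} \<union> (if odd (a (Suc i)) then {Suc i} else {})"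
    by (auto simp: le_Suc_eq)
  then show ?thesis by (simp add: nu_def)
qed

lemma nu_cases: "nu i = 1 \<or> nu i = -1"
  by (induction i) (auto simp: nu_Suc, auto simp: nu_def)

lemma odd_sign_eq: "odd_sign a i = (if odd (a i) then nu i else 0)"
  by (simp add: odd_sign_def nu_def)

lemma abs_odd_sign_le: "\<bar>real_of_int (odd_sign a i)\<bar> \<le> 1"
  using nu_cases[of i] by (auto simp: odd_sign_eq)

lemma odd_sign_P_le: "norm (of_int (odd_sign a (Suc (i + k))) * P (Suc (i + k))) \<le> P k * (2 / 3) ^ i"
proof -
  have "norm (of_int (odd_sign a (Suc (i + k))) * P (Suc (i + k))) \<le> P (Suc (i + k))"
    using abs_odd_sign_le[of "Suc (i + k)"] P_pos[of "Suc (i + k)"]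
    by (simp add: abs_mult mult_left_le_one_le)
  also have "\<dots> \<le> P (i + k)"
    using x_less_1[of "i + k"] x_pos[of "i + k"] P_pos[of "i + k"] by (simp add: P_Suc)
  also have "\<dots> \<le> P k * (2 / 3) ^ i" by (rule P_add_le)
  finally show ?thesis .
qed

lemma summable_odd_sign: "summable (\<lambda>i. of_int (odd_sign a (Suc (i + k))) * P (Suc (i + k)))"
  by (rule summable_comparison_test'[where N = 0, OF _ odd_sign_P_le])
    (auto intro: summable_mult summable_geometric)

text \<open>One term of the series is split off. The factor \<open>- nu k\<close> in
  \<open>t\<close> makes the first nonzero term positive, so the step depends only on the parity of
  the quotient.\<close>

lemma t_rec: "t k = (if odd (a (Suc k)) then x k * (1 - t (Suc k)) else x k * t (Suc k))"
proof -
  define S where "S k = (\<Sum>i. of_int (odd_sign a (Suc (i + k))) * P (Suc (i + k)))" for k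
  have S: "S k = of_int (odd_sign a (Suc k)) * P (Suc k) + S (Suc k)"
    using suminf_split_head[OF summable_odd_sign[of k]] by (simp add: S_def)
  have t: "t k = - of_int (nu k) * S k / P k" for k by (simp add: t_def S_def)
  show ?thesis
    using nu_cases[of k] P_pos[of k] x_pos[of k] unfolding t S
    by (auto simp: nu_Suc odd_sign_eq P_Suc divide_simps algebra_simps)
qed

lemma t_odd: "odd (a (Suc k)) \<Longrightarrow> t k = x k * (1 - t (Suc k))"
  and t_even: "even (a (Suc k)) \<Longrightarrow> t k = x k * t (Suc k)"
  by (subst t_rec; simp)+

text \<open>A crude start for the contraction arguments; the sharp range of \<open>t\<close> comes
  from iterating \<open>t_rec\<close>.\<close>

lemma abs_t_le: "\<bar>t k\<bar> \<le> 3"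
proof -
  let ?f = "\<lambda>i. of_int (odd_sign a (Suc (i + k))) * P (Suc (i + k))"
  have "norm (suminf ?f) \<le> (\<Sum>i. P k * (2 / 3) ^ i)"
    by (rule norm_suminf_le[OF odd_sign_P_le])
      (auto intro: summable_mult summable_geometric)
  also have "\<dots> = P k * 3"
    by (subst suminf_mult) (auto simp: suminf_geometric intro: summable_geometric)
  finally show ?thesis using P_pos[of k] nu_cases[of k]
    by (auto simp: t_def abs_mult field_simps)
qed

end

text \<open>Replaces induction for quantities that depend on the infinite tail: n steps give
  \<open>u k <= c ^ n * \<bar>B\<bar>\<close>, and n is arbitrary. \<open>Q\<close> carries the side
  conditions under which a step can be repeated.\<close>

lemma contraction_nonpos:
  fixes u :: "nat \<Rightarrow> real"
  assumes bound: "\<And>k. Q k \<Longrightarrow> u k \<le> B"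
    and step: "\<And>k. Q k \<Longrightarrow> u k \<le> 0 \<or> (\<exists>j. Q j \<and> u k \<le> c * u j)"
    and c: "0 \<le> c" "c < 1" and k: "Q k"
  shows "u k \<le> 0"
proof -
  have *: "Q k \<Longrightarrow> u k \<le> c ^ n * \<bar>B\<bar>" for n k
  proof (induction n arbitrary: k)
    case 0
    then show ?case using bound[of k] by simp
  next
    case (Suc n)
    from step[OF \<open>Q k\<close>] show ?case
    proof
      assume "u k \<le> 0"
      also have "0 \<le> c ^ Suc n * \<bar>B\<bar>" using c by simp
      finally show ?thesis .
    next
      assume "\<exists>j. Q j \<and> u k \<le> c * u j"
      then obtain j where j: "Q j" "u k \<le> c * u j" by blast
      have "c * u j \<le> c * (c ^ n * \<bar>B\<bar>)"
        using Suc.IH[OF j(1)] c by (intro mult_left_mono)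
      then show ?thesis using j by simp
    qed
  qed
  have "(\<lambda>n. c ^ n * \<bar>B\<bar>) \<longlonglongrightarrow> 0 * \<bar>B\<bar>"
    using c by (intro tendsto_intros LIMSEQ_realpow_zero)
  then show ?thesis using *[OF k] by (intro LIMSEQ_le_const[of "\<lambda>n. c ^ n * \<bar>B\<bar>" 0]) auto
qed

section \<open>Range of the right-hand sums\<close>

context adjusted_expansion
begin

text \<open>The maximum of -t and t - 1 is positive exactly when t lies outside [0, 1]. A step
  replaces t by x t or x (1 - t) with x at most 2/3, and both forms shrink this excess.\<close>

lemma t_nonneg: "0 \<le> t k" and t_le_1: "t k \<le> 1"
proof -
  have "max (- t k) (t k - 1) \<le> 0" for k
  proof (rule contraction_nonpos[where Q = "\<lambda>_. True" and c = "2 / 3" and B = 4])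
    fix k
    let ?u = "\<lambda>k. max (- t k) (t k - 1)"
    have x: "0 < x k" "x k \<le> 2 / 3" using x_pos x_le_2_3 by auto
    have *: "x k * v \<le> max 0 (2 / 3 * ?u (Suc k))" if "v \<le> ?u (Suc k)" for v
    proof (cases "v \<le> 0")
      case True
      then show ?thesis using x by (simp add: mult_nonneg_nonpos le_max_iff_disj)
    next
      case False
      then have "x k * v \<le> 2 / 3 * ?u (Suc k)" using that x by (intro mult_mono) auto
      then show ?thesis by simp
    qed
    have "- t k \<le> max 0 (2 / 3 * ?u (Suc k)) \<and> t k - 1 \<le> max 0 (2 / 3 * ?u (Suc k))"
    proof (cases "odd (a (Suc k))")
      case True
      have 1: "- t k = x k * (t (Suc k) - 1)" "t k - 1 \<le> x k * - t (Suc k)"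
        using t_odd[OF True] x by (simp_all add: right_diff_distrib)
      show ?thesis
        unfolding 1(1) using *[of "t (Suc k) - 1"] order_trans[OF 1(2) *[of "- t (Suc k)"]] by simp
    next
      case False
      have 1: "- t k = x k * - t (Suc k)" "t k - 1 \<le> x k * (t (Suc k) - 1)"
        using t_even[of k] False x by (simp_all add: right_diff_distrib)
      show ?thesis
        unfolding 1(1) using *[of "- t (Suc k)"] order_trans[OF 1(2) *[of "t (Suc k) - 1"]] by simp
    qed
    then have "?u k \<le> max 0 (2 / 3 * ?u (Suc k))" by (intro max.boundedI) blast+
    then have "?u k \<le> 0 \<or> ?u k \<le> 2 / 3 * ?u (Suc k)" by (simp only: le_max_iff_disj)
    then show "?u k \<le> 0 \<or> (\<exists>j. True \<and> ?u k \<le> 2 / 3 * ?u j)" by blast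
    show "?u k \<le> 4" using abs_t_le[of k] by auto
  qed auto
  from this[of k] show "0 \<le> t k" "t k \<le> 1" by auto
qed

lemma t_le_x: "t k \<le> x k"
  using t_nonneg[of "Suc k"] t_le_1[of "Suc k"] x_pos[of k]
  by (cases "odd (a (Suc k))") (simp_all add: t_odd[of k] t_even[of k] mult_left_le)

lemma t_le_half: "t k \<le> 1 / 2"
proof (cases "a (Suc k) = 2")
  case True
  have "x k * t (Suc k) \<le> (2 / 3) * (2 / 3)"
    using t_le_x[of "Suc k"] x_le_2_3[of "Suc k"] x_le_2_3[of k] t_nonneg[of "Suc k"]
    by (intro mult_mono) auto
  then show ?thesis using True by (simp add: t_even)
next
  case False
  then show ?thesis using t_le_x[of k] x_le_2_5[of k] a_ge_2[of "Suc k"] by simp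
qed

end

section \<open>The extremal constants\<close>

text \<open>The fixed point of the map taking v to (12 - 5 v)/(43 - 18 v), which is one full period
  of the extremal tail.\<close>

definition ystar :: real where "ystar = (4 - sqrt 10) / 3"
definition zstar :: real where "zstar = (sqrt 13 - 3) / 2"
definition sstar :: real where "sstar = (sqrt 13 - 1) / 6"
text \<open>The factor 4 is there because both coordinates of a grid point, n and the error, are
  used doubled.\<close>

definition kappa :: real where
  "kappa = 4 * ((sqrt 10 - 3) * (7 - sqrt 13) / (31 - 2 * sqrt 10 - 3 * sqrt 13))"

lemma sqrt_10_bounds: "316227 / 100000 \<le> sqrt 10" "sqrt 10 \<le> 316228 / 100000"
  by (rule real_le_rsqrt real_le_lsqrt; simp add: power2_eq_square)+

lemma sqrt_13_bounds: "360555 / 100000 \<le> sqrt 13" "sqrt 13 \<le> 360556 / 100000"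
  by (rule real_le_rsqrt real_le_lsqrt; simp add: power2_eq_square)+

lemma ystar_bounds: "2792 / 10000 \<le> ystar" "ystar \<le> 2793 / 10000"
  using sqrt_10_bounds by (auto simp: ystar_def)

lemma zstar_bounds: "3027 / 10000 \<le> zstar" "zstar \<le> 3028 / 10000"
  using sqrt_13_bounds by (auto simp: zstar_def)

lemma sstar_bounds: "4342 / 10000 \<le> sstar" "sstar \<le> 4343 / 10000"
  using sqrt_13_bounds by (auto simp: sstar_def)

lemma ystar_eq: "ystar * (43 - 18 * ystar) = 12 - 5 * ystar"
  by (simp add: ystar_def field_simps)

lemma zstar_eq: "zstar * (3 + zstar) = 1"
  by (simp add: zstar_def field_simps)

lemma sstar_eq: "sstar * (3 + zstar) = 1 + sstar"
  by (simp add: zstar_def sstar_def field_simps)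

text \<open>The equality case of the critical inequality: both fixed points inserted, with t = 0
  because the extremal tail has even quotients only.\<close>

lemma kappa_eq: "(3 - zstar - sstar) * (1 - ystar) = kappa * (13 - 5 * ystar - 5 * zstar + 2 * ystar * zstar)"
proof -
  have "31 - 2 * sqrt 10 - 3 * sqrt 13 > 0" using sqrt_10_bounds sqrt_13_bounds by simp
  moreover have sq: "sqrt 10 * (sqrt 10 * c) = 10 * c" "sqrt 13 * (sqrt 13 * c) = 13 * c" for c
    by (simp_all flip: mult.assoc)
  ultimately show ?thesis
    unfolding kappa_def ystar_def zstar_def sstar_def by (simp add: field_simps sq)
qed

lemma kappa_interval: "kappa / 4 \<in> {1 / 25.160 <.. 1 / 25.159}"
proof -
  define u v where "u = sqrt 10" and "v = sqrt 13"
  have uv: "3.16227766 \<le> u" "u \<le> 3.16227767" "3.60555127 \<le> v" "v \<le> 3.60555128"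
    unfolding u_def v_def by (rule real_le_rsqrt real_le_lsqrt; simp add: power2_eq_square)+
  have pos: "31 - 2 * u - 3 * v > 0" using uv by simp
  have "(u - 3) * (7 - v) \<le> 0.16227767 * 3.39444873"
    using uv by (intro mult_mono) auto
  then have "25.159 * ((u - 3) * (7 - v)) \<le> 31 - 2 * u - 3 * v" using uv by simp
  moreover have "(u - 3) * (7 - v) \<ge> 0.16227766 * 3.39444872"
    using uv by (intro mult_mono) auto
  then have "25.160 * ((u - 3) * (7 - v)) > 31 - 2 * u - 3 * v" using uv by simp
  ultimately show ?thesis
    unfolding kappa_def u_def[symmetric] v_def[symmetric] using pos
    by (auto simp: field_simps)
qed

lemma kappa_bounds: "158 / 1000 \<le> kappa" "kappa \<le> 159 / 1000"
  using kappa_interval by (auto simp: field_simps)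

context adjusted_expansion
begin

text \<open>The extremal tail is the periodic continuation \<open>4, -2, 2, 2, -4, -2, 2, 2, \<dots>\<close>, with value
  \<open>ystar\<close>; running once through the period is a contraction.\<close>

lemma tail_minus_t_step:
  assumes e: "\<epsilon> (Suc k) = -1" and a3: "a (Suc k) \<ge> 3" and zk: "z k \<ge> 3 / 8"
  defines "u \<equiv> \<lambda>k. x k - t k - ystar"
  shows "u k \<le> 0 \<or> (\<epsilon> (Suc (k + 4)) = -1 \<and> a (Suc (k + 4)) \<ge> 3 \<and> z (k + 4) \<ge> 3 / 8
    \<and> u k \<le> 1 / 2 * u (k + 4))"
proof -
  note ys = ystar_bounds
  have xk: "x k > 0" "t k \<ge> 0" using x_pos t_nonneg by auto
  consider "a (Suc k) = 3" | "a (Suc k) \<ge> 5" | "a (Suc k) = 4" "\<epsilon> (Suc (Suc k)) = 1"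
    | "a (Suc k) = 4" "\<epsilon> (Suc (Suc k)) = -1"
    using a3 eps_cases[of "Suc (Suc k)"] by fastforce
  then show ?thesis
  proof cases
    case 1
    have "x k * t (Suc k) \<le> 2 / 5 * (1 / 2)"
      using x_le_2_5[of k] t_le_half[of "Suc k"] t_nonneg[of "Suc k"] 1 by (intro mult_mono) auto
    then show ?thesis using ys 1 unfolding u_def by (simp add: t_odd algebra_simps)
  next
    case 2
    then show ?thesis using x_le_2_9[of k] xk ys unfolding u_def by simp
  next
    case 3
    have "x k \<le> 1 / 4" using x_le_inverse[OF 3(2)] 3 by simp
    then show ?thesis using xk ys unfolding u_def by simp
  next
    case 4
    let ?y = "x (Suc k)"
    have y: "0 < ?y" "?y \<le> 1 / 2" using x_pos x_le_half 4 by auto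
    have xk_eq: "x k = 1 / (4 - ?y)" using x_minus[of k] 4 by simp
    have tk: "t k = x k * t (Suc k)" using t_even[of k] 4 by simp
    consider "odd (a (Suc (Suc k)))" | "a (Suc (Suc k)) \<ge> 4" | "a (Suc (Suc k)) = 2"
      using a_ge_2[of "Suc (Suc k)"] by fastforce
    then show ?thesis
    proof cases
      case 1
      have "t (Suc k) \<ge> ?y / 2"
        using t_odd[OF 1] t_le_half[of "Suc (Suc k)"] y
          mult_left_mono[of "1 / 2" "1 - t (Suc (Suc k))" ?y] by simp
      then have "x k * (1 - t (Suc k)) \<le> x k * (1 - ?y / 2)"
        using xk by (intro mult_left_mono) auto
      also have "\<dots> \<le> 1 / 4" using y unfolding xk_eq by (simp add: field_simps)
      finally show ?thesis using ys tk unfolding u_def by (simp add: algebra_simps)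
    next
      case 2
      then have "x k \<le> 7 / 26"
        using x_le_2_7[of "Suc k"] unfolding xk_eq by (simp add: field_simps)
      then show ?thesis using xk ys unfolding u_def by simp
    next
      case 3
      let ?u = "x (Suc (Suc k))"
      have e3: "\<epsilon> (Suc (Suc (Suc k))) = 1" using eps_around_2 3 4 by simp
      have y_eq: "?y = 1 / (2 + ?u)" using x_plus[OF e3] 3 by simp
      have t1: "t (Suc k) = ?y * t (Suc (Suc k))" using t_even[of "Suc k"] 3 by simp
      have u0: "?u > 0" using x_pos by simp
      have "1 / z (Suc k) = 4 - z k" using z_minus[OF e] 4 by simp
      \<comment> \<open>Condition (ii) at the quotient -2. This is where the side condition on
        \<open>z k\<close> enters: 21/8 = 4 - 3/8 - 1.\<close>
      then have "1 / ?u \<le> 21 / 8" using bar_tail_ge[of "Suc k"] 3 4 zk by simp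
      then have u_ge: "?u \<ge> 8 / 21" using u0 by (simp add: field_simps)
      have y_le: "?y \<le> 21 / 50" unfolding y_eq using u_ge by (simp add: field_simps)
      \<comment> \<open>50/179 = 0.27933... lies just above \<open>ystar\<close> = 0.27924..., so
        further quotients have to be examined.\<close>
      have x_le: "x k \<le> 50 / 179" unfolding xk_eq using y_le by (simp add: field_simps)
      consider "a (Suc (Suc (Suc k))) \<ge> 4" | "a (Suc (Suc (Suc k))) = 3"
        | "a (Suc (Suc (Suc k))) = 2" "\<epsilon> (Suc (Suc (Suc (Suc k)))) = -1"
        | "a (Suc (Suc (Suc k))) = 2" "\<epsilon> (Suc (Suc (Suc (Suc k)))) = 1"
        using a_ge_2[of "Suc (Suc (Suc k))"] eps_cases[of "Suc (Suc (Suc (Suc k)))"] by fastforce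
      then show ?thesis
      proof cases
        case 1
        then show ?thesis using x_le_2_7[of "Suc (Suc k)"] u_ge by simp
      next
        case 2
        let ?t = "t (Suc (Suc k))"
        have "?t \<ge> ?u * (1 / 2)"
          using t_odd[of "Suc (Suc k)"] 2 t_le_half[of "Suc (Suc (Suc k))"] u0 by simp
        then have t2: "?t \<ge> 4 / 21" using u_ge by simp
        have "?u \<le> 2 / 5" using x_le_2_5[of "Suc (Suc k)"] 2 by simp
        then have "?y \<ge> 5 / 12" unfolding y_eq using u0 by (simp add: field_simps)
        then have "?y * ?t \<ge> 5 / 12 * (4 / 21)" using t2 by (intro mult_mono) auto
        then have "x k * (1 - ?y * ?t) \<le> 50 / 179 * (1 - 5 / 63)"
          using x_le xk y t_le_1[of "Suc (Suc k)"] t2 by (intro mult_mono) (auto simp: mult_le_one)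
        then show ?thesis using ys tk t1 unfolding u_def by (simp add: algebra_simps)
      next
        case 3
        have "?u \<ge> 1 / 2" using x_ge_inverse[of "Suc (Suc k)"] 3 by simp
        then have "?y \<le> 2 / 5" unfolding y_eq by (simp add: field_simps)
        then have "x k \<le> 5 / 18" unfolding xk_eq by (simp add: field_simps)
        then show ?thesis using xk ys unfolding u_def by simp
      next
        case 44: 4
        let ?w = "x (Suc (Suc (Suc k)))"
        have u_eq: "?u = 1 / (2 + ?w)" using x_plus[of "Suc (Suc k)"] 44 by simp
        have w0: "?w > 0" using x_pos by simp
        \<comment> \<open>The resulting bound 12/43 = 0.27907... is barely below
          \<open>ystar\<close>. Only a tail \<open>?w\<close> above 1/2 escapes, and it must start
          with 2 followed by a minus sign.\<close>
        have easy: ?thesis if "?w \<le> 1 / 2"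
        proof -
          have "?u \<ge> 2 / 5" unfolding u_eq using that w0 by (simp add: field_simps)
          then have "?y \<le> 5 / 12" unfolding y_eq by (simp add: field_simps)
          then have "x k \<le> 12 / 43" unfolding xk_eq by (simp add: field_simps)
          then show ?thesis using xk ys unfolding u_def by simp
        qed
        consider "a (Suc (Suc (Suc (Suc k)))) \<ge> 3"
          | "a (Suc (Suc (Suc (Suc k)))) = 2" "\<epsilon> (Suc (Suc (Suc (Suc (Suc k))))) = 1"
          | "a (Suc (Suc (Suc (Suc k)))) = 2" "\<epsilon> (Suc (Suc (Suc (Suc (Suc k))))) = -1"
          using a_ge_2[of "Suc (Suc (Suc (Suc k)))"] eps_cases[of "Suc (Suc (Suc (Suc (Suc k))))"]
          by fastforce
        then show ?thesis
        proof cases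
          case 1
          show ?thesis by (rule easy) (use x_le_2_5[of "Suc (Suc (Suc k))"] 1 in simp)
        next
          case 2
          show ?thesis by (rule easy) (use x_le_inverse[of "Suc (Suc (Suc k))"] 2 in simp)
        next
          case 444: 3
          let ?k = "Suc (Suc (Suc (Suc k)))"
          let ?v = "x ?k" and ?t = "t ?k"
          have w_eq: "?w = 1 / (2 - ?v)" using x_minus[of "Suc (Suc (Suc k))"] 444 by simp
          have v: "0 < ?v" "?v \<le> 1 / 2" using x_pos x_le_half 444 by auto
          have u': "?u = (2 - ?v) / (5 - 2 * ?v)"
            unfolding u_eq w_eq using v by (simp add: field_simps)
          have y': "?y = (5 - 2 * ?v) / (12 - 5 * ?v)"
            unfolding y_eq u' using v by (simp add: field_simps)
          have x': "x k = (12 - 5 * ?v) / (43 - 18 * ?v)"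
            unfolding xk_eq y' using v by (simp add: field_simps)
          have "t k = x k * (?y * (?u * (?w * ?t)))"
            using tk t1 t_even[of "Suc (Suc k)"] t_even[of "Suc (Suc (Suc k))"] 44 444 by simp
          also have "?u * (?w * ?t) = ?t / (5 - 2 * ?v)" unfolding u' w_eq using v by simp
          also have "?y * (?t / (5 - 2 * ?v)) = ?t / (12 - 5 * ?v)" unfolding y' using v by simp
          also have "x k * (?t / (12 - 5 * ?v)) = ?t / (43 - 18 * ?v)" unfolding x' using v by simp
          finally have tk': "t k = ?t / (43 - 18 * ?v)" .
          have d: "43 - 18 * ?v \<ge> 34" "43 - 18 * ystar \<ge> 34" using v ys by auto
          have "(x k - ystar) * (43 - 18 * ?v) = 12 - 5 * ?v - ystar * (43 - 18 * ?v)"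
            unfolding x' using d by (simp add: field_simps)
          \<comment> \<open>The map has determinant 12 * 18 - 5 * 43 = 1, so the distance to the
            fixed point is divided by the product of the two denominators.\<close>
          then have "(x k - ystar) * (43 - 18 * ?v) * (43 - 18 * ystar)
              = (12 - 5 * ?v - ystar * (43 - 18 * ?v)) * (43 - 18 * ystar)"
            by (rule arg_cong)
          also have "\<dots> = (12 - 5 * ?v) * (43 - 18 * ystar) - (ystar * (43 - 18 * ystar)) * (43 - 18 * ?v)"
            by (simp add: algebra_simps)
          also have "\<dots> = ?v - ystar" unfolding ystar_eq by (simp add: algebra_simps)
          finally have *: "(x k - ystar) * (43 - 18 * ?v) = (?v - ystar) / (43 - 18 * ystar)"
            using d by (simp add: field_simps)
          have uk: "u k * (43 - 18 * ?v) = (?v - ystar) / (43 - 18 * ystar) - ?t"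
            unfolding u_def using * tk' d by (simp add: left_diff_distrib)
          have t0: "?t \<ge> 0" using t_nonneg by simp
          show ?thesis
          proof (cases "u ?k \<le> 0")
            case True
            then have "(?v - ystar) / (43 - 18 * ystar) \<le> ?t / (43 - 18 * ystar)"
              using d unfolding u_def by (intro divide_right_mono) auto
            also have "\<dots> \<le> ?t"
              using d t0 divide_left_mono[of 1 "43 - 18 * ystar" ?t] by simp
            finally have "u k * (43 - 18 * ?v) \<le> 0" using uk by simp
            then show ?thesis using d by (simp add: mult_le_0_iff)
          next
            case False
            then have "(?v - ystar) / (43 - 18 * ystar) \<le> (?v - ystar) / 1"
              using d t0 unfolding u_def by (intro divide_left_mono) auto
            then have "u k * (43 - 18 * ?v) \<le> u ?k" using uk unfolding u_def by simp
            then have "u k \<le> u ?k / (43 - 18 * ?v)" using d by (simp add: field_simps)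
            also have "\<dots> \<le> u ?k / 2" using d False by (intro divide_left_mono) auto
            finally have "u k \<le> 1 / 2 * u ?k" by simp
            \<comment> \<open>The side conditions return after one period: the quotient 2 gives the
              bound on z, and condition (iv) excludes the block 2, -2.\<close>
            moreover have "z ?k \<ge> 3 / 8"
              using z_ge_3_8 444 by simp
            moreover have "a (Suc ?k) \<ge> 3" using no_block_2_2[of ?k] 44 444 by simp
            moreover have "\<epsilon> (Suc ?k) = -1" using 444 by simp
            moreover have "k + 4 = ?k" by simp
            ultimately show ?thesis by presburger
          qed
        qed
      qed
    qed
  qed
qed

lemma tail_minus_t_le:
  assumes "\<epsilon> (Suc k) = -1" "a (Suc k) \<ge> 3" "z k \<ge> 3 / 8"
  shows "x k - t k \<le> ystar"
proof -
  have "x k - t k - ystar \<le> 0"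
  proof (rule contraction_nonpos[where u = "\<lambda>k. x k - t k - ystar" and B = 1 and c = "1 / 2"
        and Q = "\<lambda>k. \<epsilon> (Suc k) = -1 \<and> a (Suc k) \<ge> 3 \<and> z k \<ge> 3 / 8"])
    fix k assume "\<epsilon> (Suc k) = -1 \<and> a (Suc k) \<ge> 3 \<and> z k \<ge> 3 / 8"
    then show "x k - t k - ystar \<le> 0 \<or> (\<exists>j. (\<epsilon> (Suc j) = -1 \<and> a (Suc j) \<ge> 3 \<and> z j \<ge> 3 / 8) \<and>
        x k - t k - ystar \<le> 1 / 2 * (x j - t j - ystar))"
      using tail_minus_t_step[of k] by blast
    show "x k - t k - ystar \<le> 1"
      using x_less_1[of k] t_nonneg[of k] ystar_bounds by simp
  qed (use assms in auto)
  then show ?thesis by simp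
qed

end

section \<open>The left extremum\<close>

text \<open>Taking c to -(sstar + c zstar) maps [-9/20, 1/20] into [-9/20, -29/100]. Hence the
  slopes stay in range however often a functional is pulled back through a quotient +3.\<close>

lemma chain_values_bounds:
  fixes c :: real
  assumes "- 9 / 20 \<le> c" "c \<le> 1 / 20"
  shows "sstar + c * zstar \<ge> 433 / 1000 + 3029 / 10000 * c" "sstar + c * zstar \<le> 9 / 20"
    "sstar + c * zstar \<ge> 297 / 1000"
proof -
  have *: "0 \<le> (c + 45 / 100) * (zstar - 3027 / 10000)" "0 \<le> (c + 45 / 100) * (3028 / 10000 - zstar)"
    "0 \<le> (5 / 100 - c) * (zstar - 3027 / 10000)" "0 \<le> (5 / 100 - c) * (3028 / 10000 - zstar)"
    using assms zstar_bounds by simp_all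
  show "sstar + c * zstar \<ge> 433 / 1000 + 3029 / 10000 * c" "sstar + c * zstar \<le> 9 / 20"
    "sstar + c * zstar \<ge> 297 / 1000"
    using * assms zstar_bounds sstar_bounds by (simp_all add: algebra_simps)
qed

text \<open>The fixed point of the left-hand recursion at a partial quotient \<open>+3\<close> is \<open>(zstar, sstar)\<close>;
  there the functional with slope \<open>c\<close> is pulled back to the one with slope \<open>-(sstar + c * zstar)\<close>.\<close>

lemma chain_pullback:
  fixes z s c :: real
  assumes "z > 0" "z * (3 + z') = 1" "s = z * (1 + s')"
    and "s' + - (sstar + c * zstar) * z' \<le> sstar + - (sstar + c * zstar) * zstar"
  shows "s + c * z \<le> sstar + c * zstar"
proof -
  let ?M = "sstar + c * zstar"
  have M: "?M * (3 + zstar) = 1 + sstar + c"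
    using arg_cong[OF zstar_eq, of "(*) c"] sstar_eq by (simp add: algebra_simps)
  have "s + c * z - ?M = z * (1 + s' + c) - ?M * (z * (3 + z'))"
    using assms by (simp add: algebra_simps)
  also have "\<dots> = z * (1 + s' + c - ?M * (3 + zstar) - ?M * (z' - zstar))"
    by (simp add: algebra_simps)
  also have "\<dots> = z * (s' + - ?M * z' - (sstar + - ?M * zstar))"
    unfolding M by (simp add: algebra_simps)
  also have "\<dots> \<le> 0" using assms by (intro mult_nonneg_nonpos) auto
  finally show ?thesis by simp
qed

context adjusted_expansion
begin

lemma odd_site: "odd (a (Suc i)) \<Longrightarrow> a (Suc i) = 3 \<or> a (Suc i) \<ge> 5"
  using a_ge_2[of "Suc i"] by simp presburger

lemma site_cases:
  obtains "even (a (Suc i))" | "odd (a (Suc i))" "a (Suc i) \<ge> 5"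
    | "a (Suc i) = 3" "\<epsilon> (Suc i) = 1" | "a (Suc i) = 3" "\<epsilon> (Suc i) = -1"
  using odd_site[of i] eps_cases[of "Suc i"] by auto

lemma s_nonneg_odd: "odd (a (Suc i)) \<Longrightarrow> s (Suc i) \<ge> 0"
  using s_odd[of i] z_pos[of i] s_bounds[of i] eps_cases[of "Suc i"] by (auto intro!: mult_nonneg_nonneg)

lemma s_ge_even_4:
  assumes "even (a (Suc i))" "a (Suc i) \<ge> 4"
  shows "s (Suc i) \<ge> - 1 / 8"
proof (cases "\<epsilon> (Suc i) = 1")
  case True
  then have "z (Suc i) \<le> 1 / of_int (a (Suc i))" by (rule z_le_inverse)
  also have "\<dots> \<le> 1 / 4" using assms by (intro divide_left_mono) auto
  finally have "s i * z (Suc i) \<le> 1 / 8"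
    using mult_right_mono[OF s_le[of i], of "z (Suc i)"] z_pos[of i] by linarith
  then show ?thesis using s_even[OF assms(1)] True by simp
next
  case False
  then have e: "\<epsilon> (Suc i) = -1" using eps_cases[of "Suc i"] by simp
  have "- s i * z (Suc i) \<le> 1 / 4 * (2 / 7)"
    using mult_right_mono[of "- s i" "1 / 4" "z (Suc i)"] z_pos[of i] z_le[of 4 i] s_ge[of i] assms by simp
  then show ?thesis using s_even[OF assms(1)] e by simp
qed

text \<open>After clearing the denominator the claim reads
  \<open>1 - s i + c <= M * (3 - z i)\<close>. It is in danger only for negative \<open>s i\<close>,
  hence only behind an even quotient. A preceding +2 is left to the assumption \<open>two\<close>,
  because what is known about it depends on the quotient after the -3.\<close>

lemma s_step_3_minus:
  assumes e: "\<epsilon> (Suc i) = -1" and a: "a (Suc i) = 3"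
    and c: "- 9 / 20 \<le> c" "c \<le> 1 / 20"
    and two: "a i = 2 \<Longrightarrow> \<epsilon> i = 1 \<Longrightarrow> i \<ge> 1 \<Longrightarrow> s i < 0 \<Longrightarrow> c \<le> - 29 / 100 \<and> s i \<ge> - 14 / 100 \<and> z i \<le> 12 / 29"
  shows "s (Suc i) + c * z (Suc i) \<le> sstar + c * zstar"
proof -
  define M where "M = sstar + c * zstar"
  have M: "M \<ge> 433 / 1000 + 3029 / 10000 * c" "M \<ge> 0"
    using chain_values_bounds[OF c] unfolding M_def by auto
  have zi: "z i \<le> 1 / 2" "0 \<le> z i" using z_le_half[OF e] z_nonneg by auto
  have zeq: "z (Suc i) = 1 / (3 - z i)" using z_minus[OF e] a by simp
  have seq: "s (Suc i) = (1 - s i) / (3 - z i)" using s_odd[of i] a e zeq by simp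
  have "1 - s i + c \<le> M * (3 - z i)"
  proof (cases "s i \<ge> 0")
    case True
    have "M * (5 / 2) \<le> M * (3 - z i)" using M zi by (intro mult_left_mono) auto
    then show ?thesis using M c True by linarith
  next
    case False
    then obtain j where j: "i = Suc j" by (cases i) auto
    have ev: "even (a i)" using s_nonneg_odd[of j] False j by auto
    show ?thesis
    proof (cases "a i = 2")
      case True
      have "\<epsilon> i = 1" using eps_around_2[of i] eps_cases[of i] True e j by auto
      then have *: "c \<le> - 29 / 100 \<and> s i \<ge> - 14 / 100 \<and> z i \<le> 12 / 29"
        using two True False j by auto
      have "M * (75 / 29) \<le> M * (3 - z i)" using M * by (intro mult_left_mono) auto
      then show ?thesis using M * by linarith
    next
      case False
      then have a4: "a i \<ge> 4" using ev a_ge_2[of i] j by (cases "a i = 3") auto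
      have "s i \<ge> - 1 / 8" "z i \<le> 2 / 7"
        using s_ge_even_4[of j] z_le[of 4 j] ev a4 j by auto
      moreover from this have "M * (19 / 7) \<le> M * (3 - z i)"
        using M by (intro mult_left_mono) auto
      ultimately show ?thesis using M c by linarith
    qed
  qed
  then have "(1 - s i + c) / (3 - z i) \<le> M" using zi by (simp add: pos_divide_le_eq)
  then show ?thesis unfolding zeq seq M_def[symmetric] by (simp add: add_divide_distrib diff_divide_distrib)
qed

lemma s_step_odd_5:
  assumes "a (Suc i) \<ge> 5" "odd (a (Suc i))" and c: "- 9 / 20 \<le> c" "c \<le> 1 / 20"
  shows "s (Suc i) + c * z (Suc i) \<le> sstar + c * zstar"
proof -
  have z: "z (Suc i) \<le> 2 / 9" "z (Suc i) > 0" using z_le[of 5 i] z_pos assms by auto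
  have "1 + of_int (\<epsilon> (Suc i)) * s i \<le> 3 / 2"
    using s_le[of i] s_ge[of i] eps_cases[of "Suc i"] by auto
  then have "s (Suc i) \<le> z (Suc i) * (3 / 2)"
    unfolding s_odd[OF assms(2)] using z by (intro mult_left_mono) auto
  then have "s (Suc i) + c * z (Suc i) \<le> (3 / 2 + c) * z (Suc i)" by (simp add: algebra_simps)
  also have "\<dots> \<le> (3 / 2 + c) * (2 / 9)" using z c by (intro mult_left_mono) auto
  also have "\<dots> \<le> sstar + c * zstar" using chain_values_bounds(1)[OF c] c by simp
  finally show ?thesis .
qed

lemma s_step_even_le:
  assumes "even (a (Suc i))"
  shows "s (Suc i) \<le> z (Suc i) / 4 \<or> \<epsilon> (Suc i) = -1 \<and> s (Suc i) \<le> z (Suc i) / 2"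
  using eps_cases[of "Suc i"] s_even[OF assms] z_pos[of i]
    mult_right_mono[of "- s i" "1 / 4" "z (Suc i)"] mult_right_mono[of "s i" "1 / 2" "z (Suc i)"]
    s_ge[of i] s_le[of i] by auto

text \<open>The slope is arbitrary in the induction, since a quotient +3 reduces the claim to the
  same claim one place to the left with another slope. Every other quotient ends the chain by a
  direct estimate.\<close>

lemma left_chain:
  assumes "\<epsilon> (Suc j) = 1" "a (Suc j) = 3" and c: "- 9 / 20 \<le> c" "c \<le> - 29 / 100"
  shows "s j + c * z j \<le> sstar + c * zstar"
  using assms
proof (induction j arbitrary: c)
  case 0
  then show ?case using chain_values_bounds(3)[of c] by simp
next
  case (Suc i)
  have c: "- 9 / 20 \<le> c" "c \<le> 1 / 20" using Suc.prems by auto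
  have M: "sstar + c * zstar \<ge> 297 / 1000" by (rule chain_values_bounds(3)[OF c])
  have z: "z (Suc i) > 0" "z (Suc i) \<le> 2 / 3" using z_pos z_le_2_3 by auto
  consider "even (a (Suc i))" | "odd (a (Suc i))" "a (Suc i) \<ge> 5"
    | "a (Suc i) = 3" "\<epsilon> (Suc i) = 1" | "a (Suc i) = 3" "\<epsilon> (Suc i) = -1"
    by (rule site_cases)
  then show ?case
  proof cases
    case 1
    have "s (Suc i) \<le> z (Suc i) / 2" using s_step_even_le[OF 1] z by auto
    moreover have "c * z (Suc i) \<le> - 29 / 100 * z (Suc i)"
      using Suc.prems z by (intro mult_right_mono) auto
    ultimately show ?thesis using M z by linarith
  next
    case 2
    then show ?thesis using s_step_odd_5 c by blast
  next
    case 3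
    have M': "sstar + c * zstar \<le> 9 / 20" using chain_values_bounds(2)[OF c] by simp
    show ?thesis
    proof (rule chain_pullback)
      show "z (Suc i) > 0" by (rule z)
      show "z (Suc i) * (3 + z i) = 1" using z_plus[OF 3(2)] 3 z_nonneg[of i] by simp
      show "s (Suc i) = z (Suc i) * (1 + s i)" using s_odd[of i] 3 by simp
      show "s i + - (sstar + c * zstar) * z i \<le> sstar + - (sstar + c * zstar) * zstar"
        using M M' 3 by (intro Suc.IH) auto
    qed
  next
    case 4
    show ?thesis
    proof (rule s_step_3_minus[OF 4(2,1) c])
      assume i: "a i = 2" "\<epsilon> i = 1" "i \<ge> 1" "s i < 0"
      then obtain l where l: "i = Suc l" by (cases i) auto
      \<comment> \<open>Condition (iii) starts at index 2; at index 1 the sum \<open>s i\<close>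
        vanishes, which contradicts its being negative.\<close>
      have "l \<noteq> 0"
      proof
        assume "l = 0"
        then have "s i = 0" using s_even[of 0] i l by simp
        then show False using i by simp
      qed
      then obtain l' where l': "l = Suc l'" by (cases l) auto
      \<comment> \<open>Condition (iii) at the 2 before the -3 gives 1/z < 3 + 2/5 - 1 = 12/5 one
        place further left, and so large a z comes only from another quotient 2.\<close>
      have "x (Suc i) \<le> 2 / 5" using x_le_2_5[of "Suc i"] Suc.prems by simp
      moreover have "1 / x i = 3 + x (Suc i)" using x_plus[of i] 4 Suc.prems by simp
      moreover have "1 / x i - 1 / z l > 1" using tail_bar_gt[of l] l l' i 4 by simp
      ultimately have "1 / z l < 12 / 5" by linarith
      then have zl: "z l > 5 / 12" using z_pos[of l'] l' by (simp add: field_simps)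
      have al: "a l = 2" using z_le[of 3 l'] a_ge_2[of l] l' zl by (cases "a l = 2") auto
      have "s l \<le> 1 / 3" using s_step_even_le[of l'] al l' z_le_2_3[of l] z_pos[of l'] by auto
      moreover have zi: "z i = 1 / (2 + z l)" using z_plus[of l] i l by simp
      then have zi': "0 < z i" "z i \<le> 12 / 29" unfolding zi using zl by (auto simp: field_simps)
      ultimately have "s l * z i \<le> 1 / 3 * (12 / 29)"
        using mult_right_mono[of "s l" "1 / 3" "z i"] by linarith
      then have "s i \<ge> - 14 / 100" using s_even[of l] i l by simp
      then show "c \<le> - 29 / 100 \<and> s i \<ge> - 14 / 100 \<and> z i \<le> 12 / 29"
        using Suc.prems zi' by simp
    qed
  qed
qed

text \<open>Entry to the chain, at the -2 of the critical block, with a small nonnegative slope.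
  Here the pattern +2, -3 to the left is ruled out by condition (iv).\<close>

lemma left_bound:
  assumes e: "\<epsilon> (Suc j) = -1" and a2: "a (Suc j) = 2" and c0: "0 \<le> c" "c \<le> 1 / 20"
  shows "s j + c * z j \<le> sstar + c * zstar"
proof (cases j)
  case 0
  then show ?thesis using chain_values_bounds(3)[of c] c0 by simp
next
  case (Suc i)
  have c: "- 9 / 20 \<le> c" "c \<le> 1 / 20" using c0 by auto
  have M: "sstar + c * zstar \<ge> 433 / 1000"
    using sstar_bounds zstar_bounds mult_nonneg_nonneg[of c zstar] c0 by linarith
  have z: "z (Suc i) > 0" "z (Suc i) \<le> 1 / 2" using z_pos z_le_half[OF e] Suc by auto
  consider "even (a (Suc i))" | "odd (a (Suc i))" "a (Suc i) \<ge> 5"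
    | "a (Suc i) = 3" "\<epsilon> (Suc i) = 1" | "a (Suc i) = 3" "\<epsilon> (Suc i) = -1"
    by (rule site_cases)
  then show ?thesis
  proof cases
    case 1
    have "s (Suc i) \<le> z (Suc i) / 2" using s_step_even_le[OF 1] z by auto
    moreover have "c * z (Suc i) \<le> 1 / 20 * z (Suc i)" using c z by (intro mult_right_mono) auto
    ultimately have "s (Suc i) + c * z (Suc i) \<le> sstar + c * zstar" using M z by linarith
    then show ?thesis using Suc by simp
  next
    case 2
    then show ?thesis using s_step_odd_5 c Suc by blast
  next
    case 3
    have M': "sstar + c * zstar \<le> 9 / 20" using chain_values_bounds(2)[OF c] by simp
    have "s (Suc i) + c * z (Suc i) \<le> sstar + c * zstar"
    proof (rule chain_pullback)
      show "z (Suc i) > 0" by (rule z)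
      show "z (Suc i) * (3 + z i) = 1" using z_plus[OF 3(2)] 3 z_nonneg[of i] by simp
      show "s (Suc i) = z (Suc i) * (1 + s i)" using s_odd[of i] 3 by simp
      show "s i + - (sstar + c * zstar) * z i \<le> sstar + - (sstar + c * zstar) * zstar"
        using M M' 3 by (intro left_chain) auto
    qed
    then show ?thesis using Suc by simp
  next
    case 4
    have "s (Suc i) + c * z (Suc i) \<le> sstar + c * zstar"
    proof (rule s_step_3_minus[OF 4(2,1) c])
      assume "a i = 2" "\<epsilon> i = 1" "i \<ge> 1"
      then have False using no_block_2_3_2[of i] 4 e a2 Suc by simp
      then show "c \<le> - 29 / 100 \<and> s i \<ge> - 14 / 100 \<and> z i \<le> 12 / 29" ..
    qed
    then show ?thesis using Suc by simp
  qed
qed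


section \<open>The vertices of a cell\<close>

text \<open>A tail starting with 2 could come close to 1/2. Condition (ii) at this -2 makes the tail
  behind it at least 3/8, and at least 1/2 if the 3 carries a minus sign.\<close>

lemma x_after_3:
  assumes "a (Suc k) = 3" "\<epsilon> (Suc (Suc k)) = -1"
  shows "x (Suc k) \<le> 8 / 19" "\<epsilon> (Suc k) = -1 \<Longrightarrow> x (Suc k) \<le> 2 / 5"
proof -
  let ?u = "x (Suc (Suc k))"
  have "x (Suc k) \<le> 8 / 19 \<and> (\<epsilon> (Suc k) = -1 \<longrightarrow> x (Suc k) \<le> 2 / 5)"
  proof (cases "a (Suc (Suc k)) = 2")
    case True
    have u0: "?u > 0" using x_pos by simp
    have e: "\<epsilon> (Suc (Suc (Suc k))) = 1" using eps_around_2 True assms by simp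
    have x1: "x (Suc k) = 1 / (2 + ?u)" using x_plus[OF e] True by simp
    have *: "1 / z (Suc k) = 3 + of_int (\<epsilon> (Suc k)) * z k" using z_Suc[of k] assms by simp
    have 1: "1 / ?u \<le> 2 + of_int (\<epsilon> (Suc k)) * z k"
      using bar_tail_ge[of "Suc k"] True assms * by simp
    have "1 / ?u \<le> 8 / 3" using 1 eps_cases[of "Suc k"] z_le_2_3[of k] z_nonneg[of k] by auto
    then have "?u \<ge> 3 / 8" using u0 by (simp add: field_simps)
    moreover have "?u \<ge> 1 / 2" if "\<epsilon> (Suc k) = -1"
    proof -
      have "1 / ?u \<le> 2" using 1 that z_nonneg[of k] by simp
      then show ?thesis using u0 by (simp add: field_simps)
    qed
    ultimately show ?thesis unfolding x1 using u0 by (auto simp: field_simps)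
  next
    case False
    then show ?thesis using x_le_2_5[of "Suc k"] a_ge_2[of "Suc (Suc k)"] by simp
  qed
  then show "x (Suc k) \<le> 8 / 19" "\<epsilon> (Suc k) = -1 \<Longrightarrow> x (Suc k) \<le> 2 / 5"
    by auto
qed

lemma right_factor_4:
  assumes "a (Suc k) \<ge> 4"
  shows "1 - x k - t k \<ge> 5 / 9"
proof (cases "odd (a (Suc k))")
  case True
  then have "a (Suc k) \<ge> 5" using odd_site[of k] assms by simp
  then show ?thesis using x_le_2_9[of k] t_le_x[of k] by simp
next
  case False
  have "x k * t (Suc k) \<le> 2 / 7 * (1 / 2)"
    using x_le_2_7[OF assms] t_le_half[of "Suc k"] x_pos[of k] t_nonneg[of "Suc k"] by (intro mult_mono) auto
  then show ?thesis using x_le_2_7[OF assms] t_even[of k] False by simp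
qed

text \<open>The delicate quotient is 2: from \<open>t (Suc k) <= x (Suc k)\<close> and
  \<open>x k * (2 + x (Suc k)) = 1\<close> the factor is at least \<open>x k\<close> itself.\<close>

lemma right_factor_plus:
  assumes "\<epsilon> (Suc (Suc k)) = 1"
  shows "1 - x k - t k \<ge> 1 / 3"
proof -
  consider "a (Suc k) = 2" | "a (Suc k) = 3" | "a (Suc k) \<ge> 4"
    using a_ge_2[of "Suc k"] by fastforce
  then show ?thesis
  proof cases
    case 1
    have x: "x k * (2 + x (Suc k)) = 1" using x_rec[of k] 1 assms by simp
    have "x k * t (Suc k) \<le> x k * x (Suc k)"
      using t_le_x[of "Suc k"] x_pos[of k] by (intro mult_left_mono) auto
    then have "1 - x k - t k \<ge> x k" using x t_even[of k] 1 by (simp add: algebra_simps)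
    then show ?thesis using x_ge_3_8[OF 1] by simp
  next
    case 2
    then show ?thesis using x_le_inverse[OF assms] t_le_x[of k] by simp
  next
    case 3
    then show ?thesis using right_factor_4[of k] by simp
  qed
qed

lemma right_factor_3_minus:
  assumes "a (Suc k) = 3" "\<epsilon> (Suc (Suc k)) = -1"
  shows "x k * (3 - x (Suc k)) = 1" "1 - x k - t k = x k * (1 - x (Suc k) + t (Suc k))"
proof -
  show 1: "x k * (3 - x (Suc k)) = 1" using x_rec[of k] assms by simp
  show "1 - x k - t k = x k * (1 - x (Suc k) + t (Suc k))"
    unfolding t_odd[of k, OF assms(1)[THEN arg_cong[of _ _ odd], simplified]] using 1 by (simp add: algebra_simps)
qed

text \<open>For an even quotient the loss in s is at most z/2 after a plus and z/4 after a minus.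
  The dependence on z is kept because the minimum 5/8 alone is too weak when the right factor is
  small.\<close>

lemma left_factor_minus_plus:
  assumes "a (Suc i) \<ge> 3"
  shows "1 - z (Suc i) + s (Suc i) \<ge> 4 / 5 \<or>
    z (Suc i) \<le> 1 / 4 \<and> 1 - z (Suc i) + s (Suc i) \<ge> 1 - 3 / 2 * z (Suc i) \<or>
    z (Suc i) \<le> 2 / 7 \<and> 1 - z (Suc i) + s (Suc i) \<ge> 1 - 5 / 4 * z (Suc i)"
proof (cases "odd (a (Suc i))")
  case True
  have "\<bar>of_int (\<epsilon> (Suc i)) * s i\<bar> \<le> 1 / 2"
    using eps_cases[of "Suc i"] s_bounds[of i] by auto
  then have "\<bar>z (Suc i) * (of_int (\<epsilon> (Suc i)) * s i)\<bar> \<le> 2 / 5 * (1 / 2)"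
    unfolding abs_mult[of "z (Suc i)"] using z_le[of 3 i] z_pos[of i] assms by (intro mult_mono) auto
  then have "z (Suc i) * (of_int (\<epsilon> (Suc i)) * s i) \<ge> - 1 / 5" by linarith
  then have "1 - z (Suc i) + s (Suc i) \<ge> 4 / 5" unfolding s_odd[OF True] distrib_left by simp
  then show ?thesis ..
next
  case False
  then have a: "a (Suc i) \<ge> 4" using assms by (cases "a (Suc i) = 3") auto
  show ?thesis
  proof (cases "\<epsilon> (Suc i) = 1")
    case True
    have "z (Suc i) \<le> 1 / of_int (a (Suc i))" using True by (rule z_le_inverse)
    also have "\<dots> \<le> 1 / 4" using a by (intro divide_left_mono) auto
    finally have "z (Suc i) \<le> 1 / 4" .
    moreover have "s i * z (Suc i) \<le> 1 / 2 * z (Suc i)"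
      using s_le[of i] z_pos[of i] by (intro mult_right_mono) auto
    ultimately show ?thesis using s_even[of i] False True by simp
  next
    case e: False
    then have "\<epsilon> (Suc i) = -1" using eps_cases[of "Suc i"] by simp
    moreover have "- s i * z (Suc i) \<le> 1 / 4 * z (Suc i)"
      using s_ge[of i] z_pos[of i] by (intro mult_right_mono) auto
    ultimately show ?thesis using s_even[of i] False z_le[of 4 i] a by simp
  qed
qed

lemma left_factor_minus_plus_ge: "a (Suc i) \<ge> 3 \<Longrightarrow> 1 - z (Suc i) + s (Suc i) \<ge> 5 / 8"
  using left_factor_minus_plus[of i] by auto

lemma left_factor_minus_minus:
  assumes "a (Suc i) \<ge> 4"
  shows "1 - z (Suc i) - s (Suc i) \<ge> 1 / 2"
proof (cases "odd (a (Suc i))")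
  case True
  then have a: "a (Suc i) \<ge> 5" using odd_site[of i] assms by simp
  show ?thesis
  proof (cases "\<epsilon> (Suc i) = 1")
    case e: True
    have "z (Suc i) \<le> 1 / of_int (a (Suc i))" using e by (rule z_le_inverse)
    also have "\<dots> \<le> 1 / 5" using a by (intro divide_left_mono) auto
    finally have "z (Suc i) * (2 + s i) \<le> 1 / 5 * (5 / 2)"
      using s_bounds[of i] z_pos[of i] by (intro mult_mono) auto
    then show ?thesis using s_odd[OF True] e by (simp add: algebra_simps)
  next
    case False
    then have e: "\<epsilon> (Suc i) = -1" using eps_cases[of "Suc i"] by simp
    have "z (Suc i) * (2 - s i) \<le> 2 / 9 * (9 / 4)"
      using s_bounds[of i] z_pos[of i] z_le[of 5 i] a by (intro mult_mono) auto
    then show ?thesis using s_odd[OF True] e by (simp add: algebra_simps)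
  qed
next
  case False
  have "\<bar>of_int (\<epsilon> (Suc i)) * s i\<bar> \<le> 1 / 2"
    using eps_cases[of "Suc i"] s_bounds[of i] by auto
  then have "\<bar>z (Suc i) * (of_int (\<epsilon> (Suc i)) * s i)\<bar> \<le> 2 / 7 * (1 / 2)"
    unfolding abs_mult[of "z (Suc i)"] using z_le[of 4 i] z_pos[of i] assms by (intro mult_mono) auto
  then show ?thesis using s_even[of i] False z_le[of 4 i] assms by (simp add: algebra_simps)
qed

lemma left_factor_plus_minus:
  "1 + z (Suc i) - s (Suc i) \<ge> 5 / 6 \<and> z (Suc i) \<le> 2 / 5 \<or>
   1 + z (Suc i) - s (Suc i) \<ge> 1 \<and> z (Suc i) \<le> 2 / 3"
proof (cases "odd (a (Suc i))")
  case True
  then have a: "a (Suc i) \<ge> 3" using odd_site[of i] by auto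
  have z: "z (Suc i) \<le> 2 / 5" "z (Suc i) > 0" using z_le[of 3 i] z_pos a by auto
  have "1 + z (Suc i) - s (Suc i) \<ge> 5 / 6"
  proof (cases "\<epsilon> (Suc i) = 1")
    case e: True
    have "z (Suc i) \<le> 1 / of_int (a (Suc i))" using e by (rule z_le_inverse)
    also have "\<dots> \<le> 1 / 3" using a by (intro divide_left_mono) auto
    finally have "z (Suc i) * s i \<le> 1 / 6"
      using mult_left_mono[OF s_le[of i], of "z (Suc i)"] z by linarith
    then show ?thesis using s_odd[OF True] e by (simp add: algebra_simps)
  next
    case False
    then have e: "\<epsilon> (Suc i) = -1" using eps_cases[of "Suc i"] by simp
    have "z (Suc i) * - s i \<le> 1 / 10"
      using mult_left_mono[of "- s i" "1 / 4" "z (Suc i)"] s_ge[of i] z by simp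
    then show ?thesis using s_odd[OF True] e by (simp add: algebra_simps)
  qed
  then show ?thesis using z by simp
next
  case False
  have "of_int (\<epsilon> (Suc i)) * s i \<ge> -1"
    using eps_cases[of "Suc i"] s_bounds[of i] by auto
  then have "z (Suc i) * (1 + of_int (\<epsilon> (Suc i)) * s i) \<ge> 0" using z_pos[of i] by simp
  then show ?thesis using s_even[of i] False z_le_2_3[of "Suc i"] by (simp add: algebra_simps)
qed

section \<open>The products at the four vertices\<close>

lemma xz_bounds: "0 \<le> x k * z k" "x k * z k \<le> 4 / 9"
proof -
  have "x k * z k \<le> 2 / 3 * (2 / 3)"
    using x_le_2_3[of k] z_le_2_3[of k] x_pos[of k] z_nonneg[of k] by (intro mult_mono) auto
  then show "0 \<le> x k * z k" "x k * z k \<le> 4 / 9" using x_pos[of k] z_nonneg[of k] by simp_all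
qed

text \<open>\<open>vertex_1\<close> to \<open>vertex_4\<close> treat (\<open>xi\<close>,
  \<open>eta\<close>), multiplied by \<open>nu k\<close>, equal to (-1, 1), (1, 1), (-1, -1), (1,
  -1). The lower bounds on \<open>a k\<close> are available because for smaller quotients the point
  is already a vertex of the preceding cell.\<close>

lemma vertex_1:
  assumes k: "k = Suc i" and a: "a k \<ge> 3"
  shows "(1 - z k + s k) * (1 + of_int (\<epsilon> (Suc k)) * x k - t k)
    \<ge> kappa * (1 + of_int (\<epsilon> (Suc k)) * x k * z k)"
proof (cases "\<epsilon> (Suc k) = 1")
  case True
  have F: "1 - z k + s k \<ge> 5 / 8" using left_factor_minus_plus_ge[of i] a k by simp
  have "kappa * (1 + x k * z k) \<le> 159 / 1000 * (13 / 9)"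
    using kappa_bounds xz_bounds[of k] by (intro mult_mono) auto
  moreover have "(1 - z k + s k) * (1 + x k - t k) \<ge> 5 / 8 * 1"
    using F t_le_x[of k] by (intro mult_mono) auto
  ultimately show ?thesis using True by simp
next
  case False
  then have e: "\<epsilon> (Suc k) = -1" using eps_cases[of "Suc k"] by simp
  have F: "1 - z k + s k \<ge> 5 / 8" using left_factor_minus_plus_ge[of i] a k by simp
  have K1: "kappa * (1 - x k * z k) \<le> kappa"
    using xz_bounds[of k] kappa_bounds by (simp add: algebra_simps)
  have easy: ?thesis if "1 - x k - t k \<ge> 1 / 3"
  proof -
    have "(1 - z k + s k) * (1 - x k - t k) \<ge> 5 / 8 * (1 / 3)"
      using F that by (intro mult_mono) auto
    then have "kappa * (1 - x k * z k) \<le> (1 - z k + s k) * (1 - x k - t k)"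
      using K1 kappa_bounds by linarith
    then show ?thesis using e by simp
  qed
  consider "a (Suc k) = 3" "\<epsilon> (Suc (Suc k)) = -1" | "\<epsilon> (Suc (Suc k)) = 1" | "a (Suc k) \<ge> 4"
  proof -
    have "\<epsilon> (Suc (Suc k)) = 1 \<or> a (Suc k) = 3 \<and> \<epsilon> (Suc (Suc k)) = -1 \<or> a (Suc k) \<ge> 4"
      using a_ge_2[of "Suc k"] eps_cases[of "Suc (Suc k)"] eps_around_2[of "Suc k"] e by simp linarith
    then show ?thesis using that by blast
  qed
  then show ?thesis
  proof cases
    case 1
    let ?y = "x (Suc k)"
    note r = right_factor_3_minus[OF 1]
    have y: "0 < ?y" "?y \<le> 2 / 5" using x_after_3(2)[OF 1 e] x_pos by auto
    \<comment> \<open>Both sides contain the factor \<open>x k\<close> by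
      \<open>right_factor_3_minus\<close>; this is what remains after cancelling it and dropping the
      nonnegative \<open>t (Suc k)\<close>.\<close>
    have core: "kappa * (3 - ?y - z k) \<le> (1 - z k + s k) * (1 - ?y)"
    proof -
      have zk: "z k \<ge> 0" "z k \<le> 1 / 2" using z_nonneg z_le_half[OF e] by auto
      have *: "kappa * (3 - ?y - z k) \<le> 159 / 1000 * (3 - ?y - z k)"
        using kappa_bounds y zk by (intro mult_right_mono) auto
      consider "1 - z k + s k \<ge> 4 / 5" | "z k \<le> 1 / 4" "1 - z k + s k \<ge> 1 - 3 / 2 * z k"
        | "z k \<le> 2 / 7" "1 - z k + s k \<ge> 1 - 5 / 4 * z k"
        using left_factor_minus_plus[of i] a k by auto
      then show ?thesis
      proof cases
        case 1
        have "4 / 5 * (1 - ?y) \<le> (1 - z k + s k) * (1 - ?y)"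
          using 1 y by (intro mult_right_mono) auto
        moreover have "159 / 1000 * (3 - ?y - z k) \<le> 4 / 5 * (1 - ?y)" using y zk by simp
        ultimately show ?thesis using * by (meson order_trans)
      next
        case 2
        have "(1 - 3 / 2 * z k) * (1 - ?y) \<le> (1 - z k + s k) * (1 - ?y)"
          using 2 y by (intro mult_right_mono) auto
        moreover have "159 / 1000 * (3 - ?y - z k) \<le> (1 - 3 / 2 * z k) * (1 - ?y)"
          using mult_nonneg_nonneg[of "1 / 4 - z k" "2 / 5 - ?y"] mult_nonneg_nonneg[of "z k" "2 / 5 - ?y"]
            2 y zk by (simp add: algebra_simps add_divide_distrib diff_divide_distrib)
        ultimately show ?thesis using * by (meson order_trans)
      next
        case 3
        have "(1 - 5 / 4 * z k) * (1 - ?y) \<le> (1 - z k + s k) * (1 - ?y)"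
          using 3 y by (intro mult_right_mono) auto
        moreover have "159 / 1000 * (3 - ?y - z k) \<le> (1 - 5 / 4 * z k) * (1 - ?y)"
          using mult_nonneg_nonneg[of "2 / 7 - z k" "2 / 5 - ?y"] mult_nonneg_nonneg[of "z k" "2 / 5 - ?y"]
            3 y zk by (simp add: algebra_simps add_divide_distrib diff_divide_distrib)
        ultimately show ?thesis using * by (meson order_trans)
      qed
    qed
    have "kappa * (1 - x k * z k) = x k * (kappa * (3 - ?y - z k))"
    proof -
      have "x k * (kappa * (3 - ?y - z k)) = kappa * (x k * (3 - ?y)) - kappa * (x k * z k)"
        by (simp add: algebra_simps)
      then show ?thesis using r(1) by (simp add: algebra_simps)
    qed
    also have "\<dots> \<le> x k * ((1 - z k + s k) * (1 - ?y + t (Suc k)))"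
    proof (intro mult_left_mono)
      have "(1 - z k + s k) * (1 - ?y) \<le> (1 - z k + s k) * (1 - ?y + t (Suc k))"
        using F t_nonneg[of "Suc k"] by (intro mult_left_mono) auto
      then show "kappa * (3 - ?y - z k) \<le> (1 - z k + s k) * (1 - ?y + t (Suc k))"
        using core by linarith
    qed (use x_pos[of k] in simp)
    also have "\<dots> = (1 - z k + s k) * (1 - x k - t k)" unfolding r(2) by simp
    finally show ?thesis using e by simp
  next
    case 2
    show ?thesis by (rule easy[OF right_factor_plus[OF 2]])
  next
    case 3
    show ?thesis by (rule easy) (use right_factor_4[OF 3] in simp)
  qed
qed

lemma vertex_2:
  assumes k: "k = Suc i"
  shows "(1 + z k + s k) * (1 - of_int (\<epsilon> (Suc k)) * x k + t k)
    \<ge> kappa * (1 + of_int (\<epsilon> (Suc k)) * x k * z k)"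
proof -
  have F: "1 + z k + s k \<ge> 3 / 4" using s_ge[of k] z_nonneg[of k] by simp
  note xz = xz_bounds[of k]
  have "kappa * (1 + of_int (\<epsilon> (Suc k)) * x k * z k) \<le> 159 / 1000 * (13 / 9)"
    using kappa_bounds xz eps_cases[of "Suc k"] by (intro mult_mono) auto
  moreover have "(1 + z k + s k) * (1 - of_int (\<epsilon> (Suc k)) * x k + t k) \<ge> 3 / 4 * (1 / 3)"
    using F x_le_2_3[of k] x_pos[of k] t_nonneg[of k] eps_cases[of "Suc k"] by (intro mult_mono) auto
  ultimately show ?thesis by linarith
qed

lemma vertex_4:
  assumes k: "k = Suc i" and a: "a k \<ge> 4"
  shows "(1 - z k - s k) * (1 + of_int (\<epsilon> (Suc k)) * x k + t k)
    \<ge> kappa * (1 + of_int (\<epsilon> (Suc k)) * x k * z k)"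
proof -
  have F: "1 - z k - s k \<ge> 1 / 2" using left_factor_minus_minus[of i] a unfolding k .
  note xz = xz_bounds[of k]
  have "kappa * (1 + of_int (\<epsilon> (Suc k)) * x k * z k) \<le> 159 / 1000 * (13 / 9)"
    using kappa_bounds xz eps_cases[of "Suc k"] by (intro mult_mono) auto
  moreover have "(1 - z k - s k) * (1 + of_int (\<epsilon> (Suc k)) * x k + t k) \<ge> 1 / 2 * (1 / 2)"
    using F x_le_half[of k] x_pos[of k] t_nonneg[of k] eps_cases[of "Suc k"] by (intro mult_mono) auto
  ultimately show ?thesis by linarith
qed

end

section \<open>The critical block -2, 2, -3, -\<close>

lemma extremal_slope_bounds:
  "0 \<le> 1 - kappa * (5 - 2 * ystar) / (1 - ystar)" "1 - kappa * (5 - 2 * ystar) / (1 - ystar) \<le> 1 / 20"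
proof -
  have "kappa * (5 - 2 * ystar) \<le> 159 / 1000 * (44416 / 10000)"
    using kappa_bounds ystar_bounds by (intro mult_mono) auto
  moreover have "158 / 1000 * (44414 / 10000) \<le> kappa * (5 - 2 * ystar)"
    using kappa_bounds ystar_bounds by (intro mult_mono) auto
  ultimately show "0 \<le> 1 - kappa * (5 - 2 * ystar) / (1 - ystar)"
    "1 - kappa * (5 - 2 * ystar) / (1 - ystar) \<le> 1 / 20"
    using ystar_bounds by (simp_all add: pos_divide_le_eq pos_le_divide_eq)
qed

text \<open>Since 3 - z - s >= 2 exceeds kappa (5 - 2 z), the difference of the two sides decreases
  in w - t, and for fixed w - t it increases in t. So the worst right side has w - t = ystar and t =
  0. The rest is linear in z and s; dividing by 1 - ystar gives s the coefficient 1 and z the slope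
  \<open>c\<close>, and \<open>kappa_eq\<close> places equality at the fixed point.\<close>

lemma extremal_inequality:
  fixes s z t w :: real
  defines "c \<equiv> 1 - kappa * (5 - 2 * ystar) / (1 - ystar)"
  assumes left: "s + c * z \<le> sstar + c * zstar" and right: "w - t \<le> ystar"
    and t: "t \<ge> 0" and z: "0 \<le> z" "z \<le> 1 / 2" and s: "s \<le> 1 / 2"
  shows "kappa * (13 - 5 * w - 5 * z + 2 * w * z) \<le> (3 - z - s) * (1 - w + t)"
proof -
  let ?E = "5 - 2 * z" and ?r = "w - t" and ?A = "3 - z - s"
  have E: "0 \<le> kappa * ?E" using kappa_bounds z by simp
  have E': "kappa * ?E \<le> 159 / 1000 * 5" using kappa_bounds z by (intro mult_mono) auto
  have c: "(1 - c) * (1 - ystar) = kappa * (5 - 2 * ystar)" using ystar_bounds by (simp add: c_def)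
  have "0 \<le> (ystar - ?r) * (?A - kappa * ?E)"
    using right E' z s by (intro mult_nonneg_nonneg) auto
  moreover have "0 \<le> t * (kappa * ?E)" by (rule mult_nonneg_nonneg[OF t E])
  moreover have "0 \<le> (1 - ystar) * (sstar + c * zstar - s - c * z)"
    using left ystar_bounds by (intro mult_nonneg_nonneg) auto
  moreover have "?A * (1 - w + t) - kappa * (13 - 5 * w - 5 * z + 2 * w * z)
      = (ystar - ?r) * (?A - kappa * ?E) + t * (kappa * ?E)
        + (?A * (1 - ystar) - kappa * (13 - 5 * ystar) + z * (kappa * (5 - 2 * ystar)))"
    by (simp add: algebra_simps)
  moreover have "?A * (1 - ystar) - kappa * (13 - 5 * ystar) + z * (kappa * (5 - 2 * ystar))
      = (1 - ystar) * (sstar + c * zstar - s - c * z)"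
  proof -
    have "kappa * (13 - 5 * ystar) = (3 - zstar - sstar) * (1 - ystar) + zstar * (kappa * (5 - 2 * ystar))"
      using kappa_eq by (simp add: algebra_simps)
    then show ?thesis unfolding c[symmetric] by (simp add: algebra_simps)
  qed
  ultimately show ?thesis by linarith
qed

context adjusted_expansion
begin

text \<open>Both sides contain the factor \<open>z k = 1 / (2 - z i)\<close>; removing it passes to
  the left neighbour of the -2, where \<open>left_bound\<close> applies. On the other side,
  condition (iv) makes the quotient after the -3 at least 3, as \<open>tail_minus_t_le\<close>
  requires.\<close>

lemma extremal_vertex:
  assumes k: "k = Suc i" and a: "a k = 2" "\<epsilon> k = -1" "a (Suc k) = 2" "\<epsilon> (Suc k) = 1"
    "a (Suc (Suc k)) = 3" "\<epsilon> (Suc (Suc k)) = -1" "\<epsilon> (Suc (Suc (Suc k))) = -1"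
  shows "kappa * ((2 + z k) * (3 - x (Suc (Suc k))) - 1)
    \<le> (1 + z k - s k) * (1 - x (Suc (Suc k)) + t (Suc (Suc k)))"
proof -
  let ?w = "x (Suc (Suc k))" and ?t = "t (Suc (Suc k))"
  have zi: "0 \<le> z i" "z i \<le> 1 / 2" using z_nonneg z_le_half a k by auto
  have zk: "z k * (2 - z i) = 1" using z_minus[of i] a k zi by simp
  have z0: "z k > 0" using z_pos k by simp
  have sk: "s k = s i * z k" using s_even[of i] a k by simp
  have "a (Suc (Suc (Suc k))) \<ge> 3" using no_block_2_3_2[of "Suc k"] a by simp
  moreover have zz: "z (Suc (Suc k)) = 1 / (3 - z (Suc k))" using z_minus[of "Suc k"] a by simp
  have "z (Suc (Suc k)) \<ge> 3 / 8"
    unfolding zz using z_ge_3_8[of k] a z_le_2_3[of "Suc k"] by (simp add: field_simps)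
  ultimately have right: "?w - ?t \<le> ystar" using tail_minus_t_le a by simp
  have left: "s i + (1 - kappa * (5 - 2 * ystar) / (1 - ystar)) * z i
      \<le> sstar + (1 - kappa * (5 - 2 * ystar) / (1 - ystar)) * zstar"
    using left_bound[of i] extremal_slope_bounds a k by simp
  have *: "kappa * (13 - 5 * ?w - 5 * z i + 2 * ?w * z i) \<le> (3 - z i - s i) * (1 - ?w + ?t)"
    using extremal_inequality[OF left right t_nonneg zi s_le] .
  have "(2 + z k) * (3 - ?w) - 1 = (2 * (z k * (2 - z i)) + z k) * (3 - ?w) - z k * (2 - z i)"
    using zk by simp
  also have "\<dots> = z k * (13 - 5 * ?w - 5 * z i + 2 * ?w * z i)" by (simp add: algebra_simps)
  finally have 1: "(2 + z k) * (3 - ?w) - 1 = z k * (13 - 5 * ?w - 5 * z i + 2 * ?w * z i)" .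
  have "1 + z k - s k = z k * (2 - z i) + z k - s i * z k" using zk sk by simp
  also have "\<dots> = z k * (3 - z i - s i)" by (simp add: algebra_simps)
  finally have 2: "1 + z k - s k = z k * (3 - z i - s i)" .
  show ?thesis unfolding 1 2 using mult_left_mono[OF *, of "z k"] z0 by (simp add: mult_ac)
qed

text \<open>With a plus after the -3, condition (iii) yields only 1/z < 2 + u, so several quotients
  \<open>a k\<close> survive; the larger right factor 1 + u pays for crude estimates.\<close>

lemma vertex_3_2_3_plus:
  assumes k: "k = Suc i" and a: "a (Suc k) = 2" "\<epsilon> (Suc k) = 1"
    "a (Suc (Suc k)) = 3" "\<epsilon> (Suc (Suc k)) = -1" "\<epsilon> (Suc (Suc (Suc k))) = 1"
  shows "kappa * ((2 + z k) * (3 + x (Suc (Suc k))) - 1) \<le> (1 + z k - s k) * (1 + x (Suc (Suc k)))"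
proof -
  let ?u = "x (Suc (Suc k))"
  have u: "0 < ?u" "?u \<le> 2 / 3" using x_pos x_le_2_3 by auto
  have z0: "z k > 0" "z k \<le> 2 / 3" using z_pos z_le_2_3 k by auto
  have "1 / x (Suc k) = 3 + ?u" using x_plus[of "Suc k"] a by simp
  then have z: "1 / z k < 2 + ?u" using tail_bar_gt[of k] a k by simp
  then have "1 / z k < 8 / 3" using u by simp
  then have z38: "z k > 3 / 8" using z0 by (simp add: field_simps)
  have a4: "a k \<le> 3"
  proof (rule ccontr)
    assume "\<not> a k \<le> 3"
    then show False using z_le[of 4 i] z38 k by simp
  qed
  have bound: ?thesis if "z k \<le> Z" "f \<le> 1 + z k - s k" "0 \<le> f"
      "159 / 1000 * ((2 + Z) * (3 + ?u) - 1) \<le> f * (1 + ?u)" for Z f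
  proof -
    have "kappa * ((2 + z k) * (3 + ?u) - 1) \<le> 159 / 1000 * ((2 + Z) * (3 + ?u) - 1)"
    proof (rule mult_mono)
      show "(2 + z k) * (3 + ?u) - 1 \<le> (2 + Z) * (3 + ?u) - 1"
        using that u by (auto intro!: mult_right_mono)
      have "2 * 3 \<le> (2 + z k) * (3 + ?u)" using u z0 by (intro mult_mono) auto
      then show "0 \<le> (2 + z k) * (3 + ?u) - 1" by simp
    qed (use kappa_bounds in auto)
    also have "\<dots> \<le> f * (1 + ?u)" by (rule that)
    also have "\<dots> \<le> (1 + z k - s k) * (1 + ?u)"
      using that u by (intro mult_right_mono) auto
    finally show ?thesis .
  qed
  consider "a k = 2" "\<epsilon> k = 1" | "a k = 2" "\<epsilon> k = -1" | "a k = 3" "\<epsilon> k = 1" | "a k = 3" "\<epsilon> k = -1"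
    using a4 a_ge_2[of k] eps_cases[of k] k by fastforce
  then show ?thesis
  proof cases
    case 1
    have "z k * (3 / 4) \<le> z k * (1 + s i)" using z0 s_ge[of i] by (intro mult_left_mono) auto
    then have "41 / 32 \<le> 1 + z k - s k"
      using s_even[of i] 1 k z38 by (simp add: algebra_simps)
    moreover have "z k \<le> 1 / 2" using z_le_inverse[of i] 1 k by simp
    ultimately show ?thesis using u by (intro bound[of "1 / 2" "41 / 32"]) auto
  next
    case 2
    have "z k \<ge> 1 / 2"
      using z_minus[of i] 2 k z_nonneg[of i] z_le_half[of i] by (simp add: frac_le)
    moreover have "z k * (1 / 2) \<le> z k * (1 - s i)"
      using z0 s_le[of i] by (intro mult_left_mono) auto
    ultimately have "5 / 4 \<le> 1 + z k - s k"
      using s_even[of i] 2 k by (simp add: algebra_simps)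
    then show ?thesis using u z0 by (intro bound[of "2 / 3" "5 / 4"]) auto
  next
    case 3
    then show ?thesis using z_le_inverse[of i] k z38 by simp
  next
    case 4
    have z25: "z k \<le> 2 / 5" using z_le[of 3 i] 4 k by simp
    then have "1 / z k \<ge> 5 / 2" using z0 by (simp add: field_simps)
    then have u2: "?u > 1 / 2" using z by linarith
    have "z k * - s i \<le> 2 / 5 * (1 / 4)"
      using mult_left_mono[of "- s i" "1 / 4" "z k"] s_ge[of i] z0 z25 by linarith
    then have "9 / 10 \<le> 1 + z k - s k" using s_odd[of i] 4 k by (simp add: algebra_simps)
    then show ?thesis using u u2 z25 by (intro bound[of "2 / 5" "9 / 10"]) auto
  qed
qed

text \<open>The tight vertex. Each use of \<open>x_rec\<close> pulls a common positive factor out of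
  both sides and moves the inequality one quotient to the right, until a crude bound suffices or the
  critical block is reached.\<close>

lemma vertex_3:
  assumes k: "k = Suc i"
  shows "(1 + z k - s k) * (1 - of_int (\<epsilon> (Suc k)) * x k - t k)
    \<ge> kappa * (1 + of_int (\<epsilon> (Suc k)) * x k * z k)"
proof (cases "\<epsilon> (Suc k) = 1")
  case False
  then have e: "\<epsilon> (Suc k) = -1" using eps_cases[of "Suc k"] by simp
  have "kappa * (1 - x k * z k) \<le> 159 / 1000 * 1"
    using kappa_bounds xz_bounds[of k] by (intro mult_mono) auto
  moreover have "(1 + z k - s k) * (1 + x k - t k) \<ge> 5 / 6 * 1"
    using left_factor_plus_minus[of i] k t_le_x[of k] by (intro mult_mono) auto
  ultimately show ?thesis using e by simp
next
  case e: True
  let ?F = "1 + z k - s k" and ?y = "x (Suc k)"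
  have x0: "x k > 0" by (rule x_pos)
  have y0: "?y > 0" by (rule x_pos)
  have z0: "z k > 0" using z_pos k by simp
  have F: "?F \<ge> 5 / 6 \<and> z k \<le> 2 / 5 \<or> ?F \<ge> 1 \<and> z k \<le> 2 / 3"
    using left_factor_plus_minus[of i] k by simp
  \<comment> \<open>The left side is known only through the two alternatives in \<open>F\<close>; a
    bound of this shape needs checking just at their extreme values.\<close>
  have lin: "kappa * (A + z k) \<le> ?F * B"
    if "A \<ge> 0" "B \<ge> 0" "159 / 1000 * (A + 2 / 5) \<le> 5 / 6 * B" "159 / 1000 * (A + 2 / 3) \<le> B" for A B
    using F
  proof
    assume *: "?F \<ge> 5 / 6 \<and> z k \<le> 2 / 5"
    have "kappa * (A + z k) \<le> 159 / 1000 * (A + 2 / 5)"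
      using kappa_bounds * that z0 by (intro mult_mono) auto
    also have "\<dots> \<le> 5 / 6 * B" by (rule that)
    also have "\<dots> \<le> ?F * B" using * that by (intro mult_right_mono) auto
    finally show ?thesis .
  next
    assume *: "?F \<ge> 1 \<and> z k \<le> 2 / 3"
    have "kappa * (A + z k) \<le> 159 / 1000 * (A + 2 / 3)"
      using kappa_bounds * that z0 by (intro mult_mono) auto
    also have "\<dots> \<le> 1 * B" using that by simp
    also have "\<dots> \<le> ?F * B" using * that by (intro mult_right_mono) auto
    finally show ?thesis .
  qed
  have easy: ?thesis if "1 - x k - t k \<ge> 1 / 3"
  proof -
    have "kappa * (3 / 2 + z k) \<le> ?F * (1 / 2)" by (rule lin) auto
    moreover have "kappa * (1 + x k * z k) \<le> kappa * (1 + 2 / 3 * z k)"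
      using kappa_bounds x_le_2_3[of k] z0 by (intro mult_left_mono add_left_mono mult_right_mono) auto
    moreover have "?F * (1 / 3) \<le> ?F * (1 - x k - t k)"
      using that F by (intro mult_left_mono) auto
    ultimately have "kappa * (1 + x k * z k) \<le> ?F * (1 - x k - t k)"
      by (simp add: algebra_simps)
    then show ?thesis using e by simp
  qed
  consider "\<epsilon> (Suc (Suc k)) = 1" | "a (Suc k) \<ge> 4" | "a (Suc k) = 3" "\<epsilon> (Suc (Suc k)) = -1"
    | "a (Suc k) = 2" "\<epsilon> (Suc (Suc k)) = -1"
    using a_ge_2[of "Suc k"] eps_cases[of "Suc (Suc k)"] by fastforce
  then show ?thesis
  proof cases
    case 1
    show ?thesis by (rule easy[OF right_factor_plus[OF 1]])
  next
    case 2
    show ?thesis by (rule easy) (use right_factor_4[OF 2] in simp)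
  next
    case 3
    note r = right_factor_3_minus[OF 3]
    have "kappa * ((3 - ?y) + z k) \<le> ?F * (1 - ?y)"
      using x_after_3(1)[OF 3] y0 by (intro lin) auto
    also have "\<dots> \<le> ?F * (1 - ?y + t (Suc k))"
      using F t_nonneg[of "Suc k"] by (intro mult_left_mono) auto
    finally have "x k * (kappa * ((3 - ?y) + z k)) \<le> x k * (?F * (1 - ?y + t (Suc k)))"
      using x0 by (intro mult_left_mono) auto
    also have "x k * (kappa * ((3 - ?y) + z k)) = kappa * (x k * (3 - ?y) + x k * z k)"
      by (simp add: algebra_simps)
    also have "x k * (?F * (1 - ?y + t (Suc k))) = ?F * (1 - x k - t k)" unfolding r(2) by simp
    finally show ?thesis unfolding r(1) using e by simp
  next
    case 4
    have xy: "x k * (2 - ?y) = 1" using x_rec[of k] 4 by simp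
    have tk: "t k = x k * t (Suc k)" using t_even[of k] 4 by simp
    have "x k * (2 - ?y) - x k - x k * t (Suc k) = x k * (1 - ?y - t (Suc k))"
      by (simp add: algebra_simps)
    then have G: "1 - x k - t k = x k * (1 - ?y - t (Suc k))" unfolding xy tk .
    have core: ?thesis if *: "kappa * ((2 - ?y) + z k) \<le> ?F * (1 - ?y - t (Suc k))"
    proof -
      have "x k * (kappa * ((2 - ?y) + z k)) \<le> x k * (?F * (1 - ?y - t (Suc k)))"
        using x0 * by (intro mult_left_mono) auto
      also have "x k * (kappa * ((2 - ?y) + z k)) = kappa * (x k * (2 - ?y) + x k * z k)"
        by (simp add: algebra_simps)
      also have "x k * (?F * (1 - ?y - t (Suc k))) = ?F * (1 - x k - t k)" unfolding G by simp
      finally show ?thesis unfolding xy using e by simp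
    qed
    have y12: "?y \<le> 1 / 2" using x_le_half 4 by simp
    have a3: "a (Suc (Suc k)) \<ge> 3" using no_block_2_2[of "Suc k"] 4 e by simp
    let ?u = "x (Suc (Suc k))" and ?t = "t (Suc (Suc k))"
    consider "a (Suc (Suc k)) \<ge> 4" | "a (Suc (Suc k)) = 3" "\<epsilon> (Suc (Suc (Suc k))) = 1"
      | "a (Suc (Suc k)) = 3" "\<epsilon> (Suc (Suc (Suc k))) = -1"
      using a3 eps_cases[of "Suc (Suc (Suc k))"] by fastforce
    then show ?thesis
    proof cases
      case 1
      show ?thesis
      proof (rule core, rule lin)
        show "159 / 1000 * (2 - ?y + 2 / 5) \<le> 5 / 6 * (1 - ?y - t (Suc k))"
          "159 / 1000 * (2 - ?y + 2 / 3) \<le> 1 - ?y - t (Suc k)" "0 \<le> 1 - ?y - t (Suc k)"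
          using right_factor_4[OF 1] y0 by auto
      qed (use y12 in auto)
    next
      case 2
      have yu: "?y * (3 + ?u) = 1" using x_rec[of "Suc k"] 2 by simp
      have t1: "t (Suc k) = ?y * (1 - ?t)" using t_odd[of "Suc k"] 2 by simp
      have "?y * (3 + ?u) - ?y - ?y * (1 - ?t) = ?y * (1 + ?u + ?t)" by (simp add: algebra_simps)
      then have G1: "1 - ?y - t (Suc k) = ?y * (1 + ?u + ?t)" unfolding yu t1 .
      have "2 * (?y * (3 + ?u)) - ?y + z k * (?y * (3 + ?u)) = ?y * ((2 + z k) * (3 + ?u) - 1)"
        by (simp add: algebra_simps)
      then have D1: "2 - ?y + z k = ?y * ((2 + z k) * (3 + ?u) - 1)" unfolding yu by simp
      have "kappa * ((2 + z k) * (3 + ?u) - 1) \<le> ?F * (1 + ?u)"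
        using vertex_3_2_3_plus[OF k] 4 e 2 by simp
      also have "\<dots> \<le> ?F * (1 + ?u + ?t)"
        using F t_nonneg[of "Suc (Suc k)"] by (intro mult_left_mono) auto
      finally show ?thesis
        using mult_left_mono[of "kappa * ((2 + z k) * (3 + ?u) - 1)" "?F * (1 + ?u + ?t)" ?y] y0
        by (intro core) (simp add: G1 D1 mult_ac)
    next
      case 3
      have yu: "?y * (3 - ?u) = 1" using x_rec[of "Suc k"] 3 by simp
      have t1: "t (Suc k) = ?y * (1 - ?t)" using t_odd[of "Suc k"] 3 by simp
      have "?y * (3 - ?u) - ?y - ?y * (1 - ?t) = ?y * (1 - ?u + ?t)" by (simp add: algebra_simps)
      then have G1: "1 - ?y - t (Suc k) = ?y * (1 - ?u + ?t)" unfolding yu t1 .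
      have "2 * (?y * (3 - ?u)) - ?y + z k * (?y * (3 - ?u)) = ?y * ((2 + z k) * (3 - ?u) - 1)"
        by (simp add: algebra_simps)
      then have D1: "2 - ?y + z k = ?y * ((2 + z k) * (3 - ?u) - 1)" unfolding yu by simp
      have "1 / ?y = 3 - ?u" using x_minus[of "Suc k"] 3 by simp
      \<comment> \<open>Condition (iii) at the quotient 2. A reversed tail above 1/2 can only end in
        the quotient 2 with a minus sign, so the right side forces the -2.\<close>
      then have "1 / z k < 2" using tail_bar_gt[of k] 4 k x_pos[of "Suc (Suc k)"] by simp
      then have z12: "z k > 1 / 2" using z0 by (simp add: field_simps)
      have ak: "a k = 2"
      proof (rule ccontr)
        assume "a k \<noteq> 2"
        then show False using z_le[of 3 i] a_ge_2[of k] z12 k by simp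
      qed
      have "\<epsilon> k \<noteq> 1" using z_le_inverse[of i] z12 ak k by auto
      then have ek: "\<epsilon> k = -1" using eps_cases[of k] k by simp
      have "kappa * ((2 + z k) * (3 - ?u) - 1) \<le> ?F * (1 - ?u + ?t)"
        using extremal_vertex[OF k ak ek] 4 e 3 by simp
      then show ?thesis
        using mult_left_mono[of "kappa * ((2 + z k) * (3 - ?u) - 1)" "?F * (1 - ?u + ?t)" ?y] y0
        by (intro core) (simp add: G1 D1 mult_ac)
    qed
  qed
qed

end

section \<open>Coordinates of the grid points\<close>

text \<open>The 2/3 bounds x and z, the 1/2 bounds t and the absolute value of s, and 4/3 is twice
  2/3; the factor 7/10 leaves room for the constant term in the formula for n.\<close>

lemma non_vertex_arithmetic:
  fixes U W p b :: real
  assumes "p = 1 \<or> p \<ge> 3" "U \<ge> 3" "U \<ge> p" "W \<ge> p + 2" "b * p \<le> U + W + 1"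
  shows "159 / 1000 * (b + 4 / 3) \<le> 7 / 10 * ((U - 2 / 3 * p - 1 / 2) * (W - 2 / 3 * p - 1 / 2))"
    "W - 2 / 3 * p - 1 / 2 \<ge> 11 / 6" "U - 2 / 3 * p - 1 / 2 \<ge> 1 / 2"
proof -
  define A B where "A = U - 2 / 3 * p - 1 / 2" and "B = W - 2 / 3 * p - 1 / 2"
  have "159 / 1000 * (b + 4 / 3) \<le> 7 / 10 * (A * B) \<and> B \<ge> 11 / 6 \<and> A \<ge> 1 / 2"
    using assms(1)
  proof
    assume p: "p = 1"
    have AB: "A \<ge> 11 / 6" "B \<ge> 11 / 6" using assms p by (auto simp: A_def B_def)
    then have "0 \<le> (A - 11 / 6) * (B - 11 / 6)" by simp
    then have "36 * (A * B) \<ge> 66 * A + 66 * B - 121" by (simp add: field_simps)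
    moreover have "b \<le> A + B + 10 / 3" using assms p by (simp add: A_def B_def)
    ultimately show ?thesis using AB by auto
  next
    assume p: "p \<ge> 3"
    have "b * 3 \<le> U + W + 1"
    proof (cases "b \<ge> 0")
      case True
      then have "b * 3 \<le> b * p" using p by (intro mult_left_mono) auto
      then show ?thesis using assms by simp
    next
      case False
      then show ?thesis using assms p by simp
    qed
    moreover have AU: "A \<ge> U / 3 - 1 / 2" "B \<ge> W / 3 + 5 / 6"
      using assms p by (auto simp: A_def B_def)
    ultimately have b: "b \<le> A + B" by linarith
    have AB: "A \<ge> 1 / 2" "B \<ge> 5 / 2" using AU assms p by auto
    then have "0 \<le> (A - 1 / 2) * (B - 5 / 2)" by simp
    then have "4 * (A * B) \<ge> 10 * A + 2 * B - 5" by (simp add: field_simps)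
    then show ?thesis using AB b by auto
  qed
  then show "159 / 1000 * (b + 4 / 3) \<le> 7 / 10 * ((U - 2 / 3 * p - 1 / 2) * (W - 2 / 3 * p - 1 / 2))"
    "W - 2 / 3 * p - 1 / 2 \<ge> 11 / 6" "U - 2 / 3 * p - 1 / 2 \<ge> 1 / 2"
    by (auto simp: A_def B_def)
qed

context adjusted_expansion
begin

section \<open>Denominators, determinant and approximation errors\<close>

abbreviation q :: "nat \<Rightarrow> real" where "q k \<equiv> of_int (cf_q a \<epsilon> k)"

lemma q_ge_1: "q k \<ge> 1" and q_Suc_ge: "q (Suc k) \<ge> q k + 1"
proof -
  have "cf_q a \<epsilon> k \<ge> 1 \<and> cf_q a \<epsilon> (Suc k) \<ge> cf_q a \<epsilon> k + 1"
    using a_ge_2 eps_cases by (intro cf_q_increasing) force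
  then show "q k \<ge> 1" "q (Suc k) \<ge> q k + 1" by linarith+
qed

lemma q_rec: "q (Suc k) = q k * (of_int (a (Suc k)) + of_int (\<epsilon> (Suc k)) * z k) \<and> z (Suc k) * q (Suc k) = q k"
proof (induction k)
  case 0
  then show ?case using a_ge_2[of 1] by (simp add: z_Suc)
next
  case (Suc k)
  let ?d = "of_int (a (Suc (Suc k))) + of_int (\<epsilon> (Suc (Suc k))) * z (Suc k)"
  have "q (Suc (Suc k)) = of_int (a (Suc (Suc k))) * q (Suc k) + of_int (\<epsilon> (Suc (Suc k))) * q k"
    by simp
  also have "\<dots> = of_int (a (Suc (Suc k))) * q (Suc k)
      + of_int (\<epsilon> (Suc (Suc k))) * (z (Suc k) * q (Suc k))"
        unfolding Suc[THEN conjunct2] ..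
  also have "\<dots> = q (Suc k) * ?d" by (simp add: algebra_simps)
  finally have 1: "q (Suc (Suc k)) = q (Suc k) * ?d" .
  have "?d > 0" using z_denominator_ge[of 2 "Suc k"] a_ge_2[of "Suc (Suc k)"] by simp
  then have "z (Suc (Suc k)) * ?d = 1" unfolding z_Suc[of "Suc k"] by simp
  then have "z (Suc (Suc k)) * q (Suc (Suc k)) = q (Suc k)"
    unfolding 1 by (metis mult.left_commute mult.right_neutral)
  then show ?case using 1 by blast
qed

lemmas q_Suc = q_rec[THEN conjunct1] and z_q = q_rec[THEN conjunct2]

text \<open>The unimodularity of consecutive convergents, q_k D_(k-1) + eps q_(k-1) D_k = 1, divided
  into the variables x and z.\<close>

lemma determinant: "q k * P k * (1 + of_int (\<epsilon> (Suc k)) * x k * z k) = 1"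
proof (induction k)
  case 0
  then show ?case by simp
next
  case (Suc k)
  let ?a = "of_int (a (Suc k)) :: real" and ?e = "of_int (\<epsilon> (Suc k)) :: real"
    and ?f = "of_int (\<epsilon> (Suc (Suc k))) :: real"
  have "q (Suc k) * P (Suc k) * (1 + ?f * x (Suc k) * z (Suc k))
      = P k * x k * (q (Suc k) + ?f * x (Suc k) * (z (Suc k) * q (Suc k)))"
    by (simp add: P_Suc algebra_simps)
  also have "\<dots> = P k * x k * (q k * (?a + ?e * z k) + ?f * x (Suc k) * q k)"
    unfolding z_q by (simp only: q_Suc)
  also have "\<dots> = q k * P k * (x k * (?a + ?f * x (Suc k)) + ?e * x k * z k)"
    by (simp add: algebra_simps)
  also have "\<dots> = 1" unfolding x_rec by (rule Suc)
  finally show ?case .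
qed

text \<open>The sign of q \<alpha> - p for the convergent of index k - 1; the start -1 is the value
  0 * \<alpha> - 1 at index -1.\<close>

primrec g :: "nat \<Rightarrow> int" where
  "g 0 = -1"
| "g (Suc k) = - \<epsilon> (Suc k) * g k"

lemma abs_g: "\<bar>g k\<bar> = 1"
proof (induction k)
  case (Suc k)
  then show ?case using eps_cases[of "Suc k"] by auto
qed simp

lemma alpha_error: "q k * \<alpha> - of_int (cf_p a \<epsilon> k) = of_int (g (Suc k)) * P (Suc k)"
proof (induction k rule: induct_nat_012)
  case 0
  then show ?case using alpha_eq by (simp add: P_Suc)
next
  case 1
  have "x 0 * (of_int (a 1) + of_int (\<epsilon> 2) * x 1) = 1"
    using x_rec[of 0] by (simp add: numeral_2_eq_2)
  from arg_cong[OF this, of "(*) (of_int (\<epsilon> 1))"] have "of_int (\<epsilon> 1) * (x 0 * of_int (a 1)) - of_int (\<epsilon> 1) = - of_int (\<epsilon> 1) * (of_int (\<epsilon> 2) * (x 0 * x 1))"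
    by (simp add: algebra_simps)
  then show ?case by (subst alpha_eq) (simp add: P_Suc algebra_simps numeral_2_eq_2)
next
  case (ge2 k)
  let ?b = "of_int (a (Suc (Suc k))) :: real" and ?e = "of_int (\<epsilon> (Suc (Suc k))) :: real"
  have e: "?e * ?e = 1" using eps_cases[of "Suc (Suc k)"] by auto
  have "q (Suc (Suc k)) * \<alpha> - of_int (cf_p a \<epsilon> (Suc (Suc k)))
      = ?b * (q (Suc k) * \<alpha> - of_int (cf_p a \<epsilon> (Suc k))) + ?e * (q k * \<alpha> - of_int (cf_p a \<epsilon> k))"
    by (simp add: algebra_simps)
  also have "\<dots> = ?b * (- ?e * of_int (g (Suc k)) * P (Suc (Suc k))) + ?e * (of_int (g (Suc k)) * P (Suc k))"
    unfolding ge2 by simp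
  also have "\<dots> = - ?e * of_int (g (Suc k)) * (?b * P (Suc (Suc k)) - P (Suc k))"
    by (simp add: algebra_simps)
  also have "\<dots> = of_int (g (Suc (Suc (Suc k)))) * P (Suc (Suc (Suc k)))"
    using P_rec[of "Suc k"] by simp
  finally show ?case .
qed

lemma cf_D_eq: "cf_D \<alpha> a \<epsilon> k = P (Suc k)"
proof -
  have "\<bar>real_of_int (g (Suc k))\<bar> = 1"
    using abs_g[of "Suc k"] by (metis of_int_1 of_int_abs)
  then show ?thesis
    unfolding cf_D_def alpha_error abs_mult using P_pos[of "Suc k"] by simp
qed

text \<open>By \<open>P_rec\<close> the part with a - 1 + eps telescopes, and the signed part is
  \<open>- t 0\<close> by definition.\<close>

lemma gamma_star_eq: "2 * gamma_star \<alpha> a \<epsilon> = 1 + of_int (\<epsilon> 1) * x 0 - t 0"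
proof -
  define f where "f i = P i + of_int (\<epsilon> (Suc i)) * P (Suc i)" for i
  have eq: "(\<lambda>i. \<bar>of_int (\<epsilon> (Suc i)) * P (Suc i)\<bar>) = (\<lambda>i. P (Suc i))"
  proof
    fix i show "\<bar>of_int (\<epsilon> (Suc i)) * P (Suc i)\<bar> = P (Suc i)"
      using eps_cases[of "Suc i"] P_pos[of "Suc i"] by auto
  qed
  have "(\<lambda>i. \<bar>of_int (\<epsilon> (Suc i)) * P (Suc i)\<bar>) \<longlonglongrightarrow> 0"
    unfolding eq by (rule LIMSEQ_Suc[OF P_tendsto_0])
  then have "(\<lambda>i. of_int (\<epsilon> (Suc i)) * P (Suc i)) \<longlonglongrightarrow> 0"
    by (rule tendsto_rabs_zero_cancel)
  then have "f \<longlonglongrightarrow> 0 + 0" unfolding f_def by (intro tendsto_add P_tendsto_0)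
  then have "(\<lambda>i. f i - f (Suc i)) sums (f 0 - 0)" by (intro telescope_sums') simp
  moreover have "f i - f (Suc i) = of_int (a (Suc i) - 1 + \<epsilon> (Suc i)) * P (Suc i)" for i
    using P_rec[of i] by (simp add: f_def algebra_simps)
  ultimately have 1: "(\<lambda>i. of_int (a (Suc i) - 1 + \<epsilon> (Suc i)) * P (Suc i)) sums (1 + of_int (\<epsilon> 1) * x 0)"
    by (simp add: f_def P_Suc)
  have "(\<lambda>i. of_int (odd_sign a (Suc i)) * P (Suc i)) sums (- t 0)"
    using summable_sums[OF summable_odd_sign[of 0]] by (simp add: t_def nu_def)
  from sums_mult[OF sums_add[OF 1 this], of "1 / 2"]
  have "(\<lambda>i. 1 / 2 * of_int (a (Suc i) - 1 + \<epsilon> (Suc i) + odd_sign a (Suc i)) * cf_D \<alpha> a \<epsilon> i)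
      sums (1 / 2 * (1 + of_int (\<epsilon> 1) * x 0 - t 0))"
    by (simp add: cf_D_eq algebra_simps)
  then show ?thesis unfolding gamma_star_def by (simp add: sums_unique[symmetric])
qed

text \<open>\<open>xi\<close> and \<open>eta\<close> are twice the coordinates of the grid point \<open>(n, n \<alpha> - m - \<gamma>)\<close> in the basis of
  the convergents \<open>k - 1\<close> and \<open>k\<close>, measured from the centre of the \<open>k\<close>-th divided cell; its vertices
  are the points with \<open>xi\<close> and \<open>eta\<close> equal to \<open>\<plusminus>1\<close>.\<close>

primrec grid :: "int \<Rightarrow> int \<Rightarrow> nat \<Rightarrow> int \<times> int" where
  "grid n m 0 = (2 * n * a 0 - 2 * m - 1, 1 - 2 * n)"
| "grid n m (Suc k) =
     (a (Suc k) * fst (grid n m k) - \<epsilon> (Suc k) * snd (grid n m k) - odd_sign a (Suc k), - fst (grid n m k))"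

definition xi :: "int \<Rightarrow> int \<Rightarrow> nat \<Rightarrow> int" where "xi n m k = fst (grid n m k)"
definition eta :: "int \<Rightarrow> int \<Rightarrow> nat \<Rightarrow> int" where "eta n m k = snd (grid n m k)"

lemma xi_Suc: "xi n m (Suc k) = a (Suc k) * xi n m k - \<epsilon> (Suc k) * eta n m k - odd_sign a (Suc k)"
  and eta_Suc: "eta n m (Suc k) = - xi n m k"
  by (simp_all add: xi_def eta_def)

lemma grid_odd: "odd (xi n m k) \<and> odd (eta n m k)"
proof (induction k)
  case 0
  then show ?case by (simp add: xi_def eta_def)
next
  case (Suc k)
  have "odd (nu (Suc k))" using nu_cases[of "Suc k"] by auto
  moreover have "odd (\<epsilon> (Suc k))" using eps_cases[of "Suc k"] by auto
  ultimately show ?case using Suc by (auto simp: xi_Suc eta_Suc odd_sign_eq)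
qed

text \<open>From k to \<open>Suc k\<close> the main term is only multiplied by -eps, as
  \<open>g\<close> is: the shift by \<open>odd_sign\<close> in \<open>xi_Suc\<close> cancels the new
  term of \<open>s\<close>. In \<open>grid_y\<close> it cancels the term removed from
  \<open>t\<close>.\<close>

lemma grid_n:
  "2 * of_int (g k) * of_int n
    = q k * (of_int (xi n m k) * z k + of_int (eta n m k) + of_int (nu k) * s k) + of_int (g k)"
proof (induction k)
  case 0
  then show ?case by (simp add: xi_def eta_def)
next
  case (Suc k)
  let ?X = "of_int (xi n m k) :: real" and ?Y = "of_int (eta n m k) :: real"
    and ?e = "of_int (\<epsilon> (Suc k)) :: real" and ?a = "of_int (a (Suc k)) :: real"
    and ?l = "of_int (odd_sign a (Suc k)) :: real"
  have s': "of_int (nu (Suc k)) * (s (Suc k) * q (Suc k)) = q k * (?l - ?e * (of_int (nu k) * s k))"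
  proof (cases "odd (a (Suc k))")
    case True
    have "s (Suc k) * q (Suc k) = (z (Suc k) * q (Suc k)) * (1 + ?e * s k)"
      unfolding s_odd[OF True] by (simp only: mult_ac)
    then have "s (Suc k) * q (Suc k) = q k * (1 + ?e * s k)" unfolding z_q .
    then show ?thesis using True by (simp add: nu_Suc odd_sign_eq algebra_simps)
  next
    case False
    have "s (Suc k) * q (Suc k) = - ?e * s k * (z (Suc k) * q (Suc k))"
      using s_even[of k] False by (simp only: mult.assoc) simp
    then have "s (Suc k) * q (Suc k) = - ?e * s k * q k" unfolding z_q .
    then show ?thesis using False by (simp add: nu_Suc odd_sign_eq)
  qed
  have "q (Suc k) * (of_int (xi n m (Suc k)) * z (Suc k) + of_int (eta n m (Suc k)) + of_int (nu (Suc k)) * s (Suc k))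
      = of_int (xi n m (Suc k)) * (z (Suc k) * q (Suc k)) - ?X * q (Suc k)
        + of_int (nu (Suc k)) * (s (Suc k) * q (Suc k))"
    by (simp add: eta_Suc algebra_simps)
  also have "\<dots> = (?a * ?X - ?e * ?Y - ?l) * q k - ?X * (q k * (?a + ?e * z k))
        + q k * (?l - ?e * (of_int (nu k) * s k))"
    unfolding s' z_q by (simp only: xi_Suc of_int_diff of_int_mult q_Suc)
  also have "\<dots> = - ?e * (q k * (?X * z k + ?Y + of_int (nu k) * s k))"
    by (simp add: algebra_simps)
  finally have *: "q (Suc k) * (of_int (xi n m (Suc k)) * z (Suc k) + of_int (eta n m (Suc k)) + of_int (nu (Suc k)) * s (Suc k))
      = - ?e * (q k * (?X * z k + ?Y + of_int (nu k) * s k))" .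
  have "2 * of_int (g (Suc k)) * of_int n = - ?e * (2 * of_int (g k) * of_int n)" by simp
  also have "\<dots> = - ?e * (q k * (?X * z k + ?Y + of_int (nu k) * s k)) + of_int (g (Suc k))"
    unfolding Suc by (simp add: algebra_simps)
  finally show ?case unfolding * .
qed

lemma grid_y:
  "2 * (of_int n * \<alpha> - of_int m - gamma_star \<alpha> a \<epsilon>)
    = P k * (of_int (xi n m k) - of_int (eta n m k) * of_int (\<epsilon> (Suc k)) * x k + of_int (nu k) * t k)"
proof (induction k)
  case 0
  have "2 * (of_int n * \<alpha> - of_int m - gamma_star \<alpha> a \<epsilon>)
      = 2 * of_int n * \<alpha> - 2 * of_int m - (1 + of_int (\<epsilon> 1) * x 0 - t 0)"
    unfolding gamma_star_eq[symmetric] by simp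
  then show ?case by (subst (asm) alpha_eq) (simp add: xi_def eta_def nu_def algebra_simps)
next
  case (Suc k)
  let ?X = "of_int (xi n m k) :: real" and ?Y = "of_int (eta n m k) :: real"
    and ?e = "of_int (\<epsilon> (Suc k)) :: real" and ?a = "of_int (a (Suc k)) :: real"
    and ?l = "of_int (odd_sign a (Suc k)) :: real" and ?f = "of_int (\<epsilon> (Suc (Suc k))) :: real"
  have t': "of_int (nu k) * t k = x k * (of_int (nu (Suc k)) * t (Suc k) - ?l)"
    by (cases "odd (a (Suc k))") (simp_all add: t_odd[of k] t_even[of k] nu_Suc odd_sign_eq algebra_simps)
  have "P (Suc k) * (of_int (xi n m (Suc k)) - of_int (eta n m (Suc k)) * ?f * x (Suc k) + of_int (nu (Suc k)) * t (Suc k))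
      = P k * (?X * (x k * (?a + ?f * x (Suc k))) - ?Y * ?e * x k + x k * (of_int (nu (Suc k)) * t (Suc k) - ?l))"
    by (simp add: xi_Suc eta_Suc P_Suc algebra_simps)
  also have "\<dots> = P k * (?X - ?Y * ?e * x k + of_int (nu k) * t k)"
    unfolding x_rec t' by simp
  finally show ?case using Suc by simp
qed


section \<open>The lower bound\<close>

abbreviation err :: "int \<Rightarrow> int \<Rightarrow> real" where
  "err n m \<equiv> \<bar>of_int n * \<alpha> - of_int m - gamma_star \<alpha> a \<epsilon>\<bar>"

lemma abs_n_ge:
  "2 * \<bar>of_int n\<bar> \<ge> q k * \<bar>of_int (xi n m k) * z k + of_int (eta n m k) + of_int (nu k) * s k\<bar> - 1"
  and abs_n_le:
  "2 * \<bar>of_int n\<bar> \<le> q k * \<bar>of_int (xi n m k) * z k + of_int (eta n m k) + of_int (nu k) * s k\<bar> + 1"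
proof -
  let ?E = "of_int (xi n m k) * z k + of_int (eta n m k) + of_int (nu k) * s k"
  have g: "\<bar>real_of_int (g k)\<bar> = 1" using abs_g[of k] by (metis of_int_1 of_int_abs)
  have "2 * \<bar>real_of_int n\<bar> = \<bar>2 * of_int (g k) * of_int n\<bar>"
    by (simp add: abs_mult g)
  also have "\<dots> = \<bar>q k * ?E + of_int (g k)\<bar>" unfolding grid_n[of k n m] ..
  finally have 1: "2 * \<bar>real_of_int n\<bar> = \<bar>q k * ?E + of_int (g k)\<bar>" .
  have 2: "\<bar>q k * ?E\<bar> = q k * \<bar>?E\<bar>" using q_ge_1[of k] by (simp add: abs_mult)
  show "2 * \<bar>of_int n\<bar> \<ge> q k * \<bar>?E\<bar> - 1" "2 * \<bar>of_int n\<bar> \<le> q k * \<bar>?E\<bar> + 1"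
    using 1 2 g by linarith+
qed

lemma err_eq:
  "2 * err n m = P k * \<bar>of_int (xi n m k) - of_int (eta n m k) * of_int (\<epsilon> (Suc k)) * x k + of_int (nu k) * t k\<bar>"
proof -
  have "2 * err n m = \<bar>2 * (of_int n * \<alpha> - of_int m - gamma_star \<alpha> a \<epsilon>)\<bar>"
    unfolding abs_mult by simp
  also have "\<dots> = P k * \<bar>of_int (xi n m k) - of_int (eta n m k) * of_int (\<epsilon> (Suc k)) * x k + of_int (nu k) * t k\<bar>"
    unfolding grid_y[of n m k] abs_mult using P_pos[of k] by simp
  finally show ?thesis .
qed

lemma err_ge: "2 * err n m \<ge> P k * (\<bar>of_int (xi n m k)\<bar> - 2 / 3 * \<bar>of_int (eta n m k)\<bar> - 1 / 2)"
proof -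
  let ?X = "of_int (xi n m k) :: real" and ?Y = "of_int (eta n m k) :: real"
    and ?e = "of_int (\<epsilon> (Suc k)) :: real" and ?v = "of_int (nu k) :: real"
  have "\<bar>- (?Y * ?e * x k)\<bar> \<le> 2 / 3 * \<bar>?Y\<bar>"
    using eps_cases[of "Suc k"] x_le_2_3[of k] x_pos[of k] mult_left_mono[of "x k" "2 / 3" "\<bar>?Y\<bar>"]
    by (auto simp: abs_mult)
  moreover have "\<bar>?v * t k\<bar> \<le> 1 / 2"
    using nu_cases[of k] t_nonneg[of k] t_le_half[of k] by auto
  ultimately have "\<bar>?X\<bar> - 2 / 3 * \<bar>?Y\<bar> - 1 / 2 \<le> \<bar>?X - ?Y * ?e * x k + ?v * t k\<bar>"
    by linarith
  then show ?thesis unfolding err_eq[of n m k] using P_pos[of k] by (intro mult_left_mono) auto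
qed

text \<open>In a fixed cell a large n with eta dominated by xi makes xi large, so the error is at
  least \<open>P k / 2\<close> and the product is far above \<open>kappa\<close>.\<close>

lemma far_points:
  assumes n: "\<bar>of_int n\<bar> \<ge> 10 * q k" "\<bar>of_int n\<bar> \<ge> 1 / P k" and le: "\<bar>eta n m k\<bar> \<le> \<bar>xi n m k\<bar>"
  shows "4 * (\<bar>of_int n\<bar> * err n m) \<ge> kappa"
proof -
  let ?X = "of_int (xi n m k) :: real" and ?Y = "of_int (eta n m k) :: real"
  have YX: "\<bar>?Y\<bar> \<le> \<bar>?X\<bar>" using le by linarith
  have "\<bar>?X * z k\<bar> \<le> \<bar>?X\<bar>"
    using z_nonneg[of k] z_le_2_3[of k] by (simp add: abs_mult mult_left_le)
  moreover have "\<bar>of_int (nu k) * s k\<bar> \<le> 1 / 2"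
    using nu_cases[of k] s_bounds[of k] by auto
  ultimately have "\<bar>?X * z k + ?Y + of_int (nu k) * s k\<bar> \<le> 2 * \<bar>?X\<bar> + 1 / 2"
    using YX by linarith
  then have "q k * \<bar>?X * z k + ?Y + of_int (nu k) * s k\<bar> \<le> q k * (2 * \<bar>?X\<bar> + 1 / 2)"
    using q_ge_1[of k] by (intro mult_left_mono) auto
  then have "20 * q k \<le> q k * (2 * \<bar>?X\<bar> + 1 / 2) + 1"
    using abs_n_le[of n k m] n by linarith
  also have "\<dots> \<le> q k * (2 * \<bar>?X\<bar> + 3 / 2)"
    using q_ge_1[of k] by (simp add: algebra_simps)
  finally have "20 \<le> 2 * \<bar>?X\<bar> + 3 / 2" using q_ge_1[of k] by (simp add: mult.commute)
  then have "\<bar>?X\<bar> - 2 / 3 * \<bar>?Y\<bar> - 1 / 2 \<ge> 1" using YX by linarith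
  then have "P k * 1 \<le> P k * (\<bar>?X\<bar> - 2 / 3 * \<bar>?Y\<bar> - 1 / 2)"
    using P_pos[of k] by (intro mult_left_mono) auto
  then have e: "2 * err n m \<ge> P k" using err_ge[where k = k and n = n and m = m] by linarith
  have "1 / P k * P k \<le> \<bar>of_int n\<bar> * (2 * err n m)"
    using e n P_pos[of k] by (intro mult_mono) auto
  then show ?thesis using P_pos[of k] kappa_bounds by simp
qed

text \<open>n is estimated in cell \<open>i\<close>, where eta dominates, and the error in cell
  \<open>k\<close>, where xi dominates, so neither leading term can cancel. The price is the factor
  of about \<open>a k\<close> in \<open>qP\<close>, which \<open>ap\<close> controls.\<close>

lemma non_vertex:
  assumes k: "k = Suc i" "i \<ge> 1" and ge: "\<bar>xi n m k\<bar> \<ge> \<bar>eta n m k\<bar>" "\<bar>xi n m k\<bar> \<noteq> 1"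
    and lt: "\<bar>xi n m i\<bar> < \<bar>eta n m i\<bar>"
  shows "4 * (\<bar>of_int n\<bar> * err n m) \<ge> kappa"
proof -
  define U W p where "U = \<bar>xi n m k\<bar>" and "W = \<bar>eta n m i\<bar>" and "p = \<bar>eta n m k\<bar>"
  have p: "p = \<bar>xi n m i\<bar>" using eta_Suc[of n m i] k by (simp add: p_def)
  have odds: "odd U" "odd W" "odd p" using grid_odd by (auto simp: U_def W_def p_def)
  have U3: "U \<ge> 3" "U \<ge> p" using ge odds(1) by (auto simp: U_def p_def) presburger
  have p1: "p = 1 \<or> p \<ge> 3" using odds(3) by (auto simp: p_def) presburger
  have Wp: "W \<ge> p + 2" using lt odds(2,3) unfolding p W_def[symmetric] by presburger
  have l: "\<bar>odd_sign a k\<bar> \<le> 1" using nu_cases[of k] by (auto simp: odd_sign_eq)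
  have "a k * xi n m i = xi n m k + \<epsilon> k * eta n m i + odd_sign a k"
    using xi_Suc[of n m i] k by simp
  moreover have "\<bar>a k * xi n m i\<bar> = a k * p"
    using a_ge_2[of k] k by (simp add: p abs_mult)
  moreover have "\<bar>\<epsilon> k * eta n m i\<bar> = W"
    using eps_cases[of k] k by (auto simp: W_def)
  ultimately have ap: "a k * p \<le> U + W + 1" using l unfolding U_def by linarith
  define A B where "A = of_int U - 2 / 3 * of_int p - (1 / 2 :: real)"
    and "B = of_int W - 2 / 3 * of_int p - (1 / 2 :: real)"
  have ap': "real_of_int (a k) * of_int p \<le> of_int U + of_int W + 1"
    using ap by (metis of_int_1 of_int_add of_int_le_iff of_int_mult)
  have arith: "159 / 1000 * (of_int (a k) + 4 / 3) \<le> 7 / 10 * (A * B)" "B \<ge> 11 / 6" "A \<ge> 1 / 2"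
    unfolding A_def B_def
    using non_vertex_arithmetic[of "of_int p" "of_int U" "of_int W" "of_int (a k)"] p1 U3 Wp ap' by auto
  have y: "2 * err n m \<ge> P k * A"
    using err_ge[where k = k and n = n and m = m] by (simp add: A_def U_def p_def)
  have "\<bar>of_int (xi n m i) * z i\<bar> \<le> 2 / 3 * of_int p"
    using z_nonneg[of i] z_le_2_3[of i] mult_left_mono[of "z i" "2 / 3" "\<bar>of_int (xi n m i)\<bar>"]
    by (simp add: abs_mult p)
  moreover have "\<bar>of_int (nu i) * s i\<bar> \<le> 1 / 2"
    using nu_cases[of i] s_bounds[of i] by auto
  moreover have "\<bar>of_int (eta n m i)\<bar> = real_of_int W" by (simp add: W_def)
  ultimately have "B \<le> \<bar>of_int (xi n m i) * z i + of_int (eta n m i) + of_int (nu i) * s i\<bar>"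
    unfolding B_def by linarith
  then have "q i * B \<le> q i * \<bar>of_int (xi n m i) * z i + of_int (eta n m i) + of_int (nu i) * s i\<bar>"
    using q_ge_1[of i] by (intro mult_left_mono) auto
  then have "2 * \<bar>of_int n\<bar> \<ge> q i * B - 1" using abs_n_ge[of i n m] by linarith
  moreover have "q i \<ge> 2" using q_Suc_ge[of "i - 1"] q_ge_1[of "i - 1"] k by simp
  then have "2 * (11 / 6) \<le> q i * B" using arith by (intro mult_mono) auto
  \<comment> \<open>Here \<open>q i * B\<close> is at least 11/3, so the subtracted 1 costs less
    than 3/10 of it.\<close>
  ultimately have x: "2 * \<bar>of_int n\<bar> \<ge> 7 / 10 * (q i * B)" by linarith
  have qP: "q i * P k * (of_int (a k) + of_int (\<epsilon> (Suc k)) * x k + of_int (\<epsilon> k) * z i) = 1"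
  proof -
    have "q i * P k * (of_int (a k) + of_int (\<epsilon> (Suc k)) * x k + of_int (\<epsilon> k) * z i)
        = q i * P i * (x i * (of_int (a k) + of_int (\<epsilon> (Suc k)) * x k) + of_int (\<epsilon> k) * x i * z i)"
      using k by (simp add: P_Suc algebra_simps)
    also have "\<dots> = 1" using x_rec[of i] determinant[of i] k by simp
    finally show ?thesis .
  qed
  have "of_int (\<epsilon> (Suc k)) * x k \<le> 2 / 3" "of_int (\<epsilon> k) * z i \<le> 2 / 3"
    using eps_cases[of "Suc k"] eps_cases[of k] k x_le_2_3[of k] x_pos[of k] z_le_2_3[of i] z_nonneg[of i] by auto
  then have "1 \<le> q i * P k * (of_int (a k) + 4 / 3)"
    unfolding qP[symmetric] using q_ge_1[of i] P_pos[of k] by (intro mult_left_mono) auto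
  then have "159 / 1000 * 1 \<le> 159 / 1000 * (q i * P k * (of_int (a k) + 4 / 3))"
    by (intro mult_left_mono) auto
  also have "\<dots> = q i * P k * (159 / 1000 * (of_int (a k) + 4 / 3))" by simp
  also have "\<dots> \<le> q i * P k * (7 / 10 * (A * B))"
    using arith(1) q_ge_1[of i] P_pos[of k] by (intro mult_left_mono) auto
  also have "\<dots> = (7 / 10 * (q i * B)) * (P k * A)" by simp
  also have "\<dots> \<le> (2 * \<bar>of_int n\<bar>) * (2 * err n m)"
    using arith P_pos[of k] by (intro mult_mono[OF x y]) auto
  finally show ?thesis using kappa_bounds by simp
qed

text \<open>The loss \<open>3 * P k\<close> comes from the term \<open>g k\<close> in
  \<open>grid_n\<close>, multiplied by \<open>P k * G\<close> with G at most 3.\<close>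

lemma vertex:
  assumes k: "k = Suc i" and ge: "\<bar>xi n m k\<bar> = 1" "\<bar>eta n m k\<bar> = 1"
    and lt: "\<bar>xi n m i\<bar> < \<bar>eta n m i\<bar>"
  shows "4 * (\<bar>of_int n\<bar> * err n m) \<ge> kappa - 3 * P k"
proof -
  let ?e = "of_int (\<epsilon> (Suc k)) :: real"
  define X Y where "X = nu k * xi n m k" and "Y = nu k * eta n m k"
  have nu2: "nu k * nu k = 1" using nu_cases[of k] by auto
  have XY: "xi n m k = nu k * X" "eta n m k = nu k * Y"
    by (simp_all add: X_def Y_def nu2 flip: mult.assoc)
  have X: "X = 1 \<or> X = -1" and Y: "Y = 1 \<or> Y = -1"
    using ge nu_cases[of k] by (auto simp: X_def Y_def)
  \<comment> \<open>In the preceding cell xi is 1 in absolute value and eta exceeds it. Rewritten in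
    the current coordinates, this excludes small \<open>a k\<close> when X and Y differ in
    sign.\<close>
  have prev: "\<bar>a k * Y + (if odd (a k) then 1 else 0) + X\<bar> \<ge> 2"
  proof -
    have "xi n m i = - eta n m k" using eta_Suc[of n m i] k by simp
    moreover have "xi n m k = a k * xi n m i - \<epsilon> k * eta n m i - odd_sign a k"
      using xi_Suc[of n m i] k by simp
    ultimately have "\<epsilon> k * eta n m i = - (a k * eta n m k + odd_sign a k + xi n m k)"
      by simp
    also have "\<dots> = - nu k * (a k * Y + (if odd (a k) then 1 else 0) + X)"
      unfolding XY by (simp add: odd_sign_eq algebra_simps)
    finally have "\<bar>\<epsilon> k * eta n m i\<bar> = \<bar>a k * Y + (if odd (a k) then 1 else 0) + X\<bar>"
      using nu_cases[of k] by (auto simp: abs_mult)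
    moreover have "\<bar>\<epsilon> k * eta n m i\<bar> = \<bar>eta n m i\<bar>"
      using eps_cases[of k] k by auto
    moreover have "\<bar>xi n m i\<bar> = 1" using \<open>xi n m i = - eta n m k\<close> ge by simp
    ultimately show ?thesis using lt by linarith
  qed
  define F where "F = \<bar>of_int X * z k + of_int Y + s k\<bar>"
  define G where "G = \<bar>of_int X - of_int Y * ?e * x k + t k\<bar>"
  have nuabs: "\<bar>real_of_int (nu k)\<bar> = 1" using nu_cases[of k] by auto
  have "of_int (xi n m k) * z k + of_int (eta n m k) + of_int (nu k) * s k = of_int (nu k) * (of_int X * z k + of_int Y + s k)"
    unfolding XY by (simp add: algebra_simps)
  then have x: "2 * \<bar>of_int n\<bar> \<ge> q k * F - 1"
    using abs_n_ge[of k n m] by (simp add: F_def abs_mult nuabs)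
  have "of_int (xi n m k) - of_int (eta n m k) * ?e * x k + of_int (nu k) * t k = of_int (nu k) * (of_int X - of_int Y * ?e * x k + t k)"
    unfolding XY by (simp add: algebra_simps)
  then have y: "2 * err n m = P k * G"
    unfolding err_eq[of n m k] by (simp add: G_def abs_mult nuabs)
  have e: "?e = 1 \<or> ?e = -1" using eps_cases[of "Suc k"] by auto
  have FG: "F * G \<ge> kappa * (1 + ?e * x k * z k)"
  proof -
    consider "X = 1" "Y = 1" | "X = -1" "Y = -1" | "X = -1" "Y = 1" | "X = 1" "Y = -1"
      using X Y by blast
    then show ?thesis
    proof cases
      case 1
      have "(1 + z k + s k) * (1 - ?e * x k + t k) \<le> F * G"
        unfolding F_def G_def abs_mult[symmetric] using 1 by (intro order_trans[OF _ abs_ge_self]) (simp add: algebra_simps)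
      then show ?thesis using vertex_2[OF k] by linarith
    next
      case 2
      have "(1 + z k - s k) * (1 - ?e * x k - t k) \<le> F * G"
        unfolding F_def G_def abs_mult[symmetric] using 2 by (intro order_trans[OF _ abs_ge_self]) (simp add: algebra_simps)
      then show ?thesis using vertex_3[OF k] by linarith
    next
      case 3
      have "(1 - z k + s k) * (1 + ?e * x k - t k) \<le> F * G"
        unfolding F_def G_def abs_mult[symmetric] using 3 by (intro order_trans[OF _ abs_ge_minus_self]) (simp add: algebra_simps)
      moreover have "a k \<ge> 3" using prev 3 a_ge_2[of k] k by (cases "a k = 2") auto
      ultimately show ?thesis using vertex_1[OF k] by linarith
    next
      case 4
      have "(1 - z k - s k) * (1 + ?e * x k + t k) \<le> F * G"
        unfolding F_def G_def abs_mult[symmetric] using 4 by (intro order_trans[OF _ abs_ge_minus_self]) (simp add: algebra_simps)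
      moreover have "a k \<ge> 4"
        using prev 4 a_ge_2[of k] k by (cases "a k = 2"; cases "a k = 3") auto
      ultimately show ?thesis using vertex_4[OF k] by linarith
    qed
  qed
  have G3: "0 \<le> G" "G \<le> 3"
  proof -
    have "\<bar>of_int Y * ?e * x k\<bar> \<le> 1"
      using Y e x_pos[of k] x_less_1[of k] by (auto simp: abs_mult)
    moreover have "\<bar>of_int X\<bar> = (1::real)" using X by auto
    ultimately show "G \<le> 3" using t_nonneg[of k] t_le_1[of k] unfolding G_def by linarith
  qed (simp add: G_def)
  have "kappa = q k * P k * (kappa * (1 + ?e * x k * z k))"
    using determinant[of k] by (simp add: mult_ac)
  also have "\<dots> \<le> q k * P k * (F * G)"
    using FG q_ge_1[of k] P_pos[of k] by (intro mult_left_mono) auto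
  finally have "kappa - P k * 3 \<le> q k * P k * (F * G) - P k * G"
    using mult_left_mono[OF G3(2), of "P k"] P_pos[of k] by linarith
  also have "\<dots> = (q k * F - 1) * (P k * G)" by (simp add: algebra_simps)
  also have "\<dots> \<le> (2 * \<bar>of_int n\<bar>) * (P k * G)"
    using x G3 P_pos[of k] by (intro mult_right_mono) auto
  also have "\<dots> = 4 * (\<bar>of_int n\<bar> * err n m)" unfolding y[symmetric] by simp
  finally show ?thesis by (simp add: mult.commute)
qed

text \<open>Infinite descent: \<open>eta (Suc k)\<close> is \<open>- xi k\<close>, so otherwise the
  absolute values of eta would decrease forever.\<close>

lemma first_cell: "\<exists>k. \<bar>eta n m k\<bar> \<le> \<bar>xi n m k\<bar>"
proof (rule ccontr)
  assume "\<nexists>k. \<bar>eta n m k\<bar> \<le> \<bar>xi n m k\<bar>"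
  then have *: "\<bar>eta n m (Suc k)\<bar> < \<bar>eta n m k\<bar>" for k by (simp add: eta_Suc not_le)
  have "\<bar>eta n m k\<bar> + int k \<le> \<bar>eta n m 0\<bar>" for k
  proof (induction k)
    case (Suc k)
    then show ?case using *[of k] by simp
  qed simp
  from this[of "Suc (nat \<bar>eta n m 0\<bar>)"] show False by simp
qed

lemma eventually_bound:
  assumes "\<delta> > 0"
  shows "\<exists>N. \<forall>n m. \<bar>of_int n\<bar> \<ge> (N::real) \<longrightarrow> 4 * (\<bar>of_int n\<bar> * err n m) \<ge> kappa - \<delta>"
proof -
  have "\<forall>\<^sub>F k in sequentially. P k < \<delta> / 3"
    using P_tendsto_0 assms by (intro order_tendstoD(2)[of P 0]) auto
  then obtain L where L: "\<And>k. k \<ge> L \<Longrightarrow> P k < \<delta> / 3"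
    by (auto simp: eventually_sequentially)
  \<comment> \<open>N serves the finitely many cells in which \<open>P k\<close> need not be small.
    The index L + 1 instead of L ensures that all other cells have k >= 2, as
    \<open>non_vertex\<close> requires.\<close>
  define N where "N = (\<Sum>k\<le>L + 1. 10 * q k + 1 / P k)"
  have pos: "10 * q k \<ge> 0" "1 / P k \<ge> 0" for k using q_ge_1[of k] P_pos[of k] by (simp_all add: less_imp_le)
  have N: "10 * q k \<le> N \<and> 1 / P k \<le> N" if "k \<le> L + 1" for k
  proof -
    have "10 * q k + 1 / P k \<le> N"
      unfolding N_def using that by (intro member_le_sum) (auto intro: add_nonneg_nonneg pos)
    then show ?thesis using pos[of k] by linarith
  qed
  show ?thesis
  proof (intro exI allI impI)
    fix n m :: int
    assume n: "\<bar>of_int n\<bar> \<ge> N"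
    define k where "k = (LEAST k. \<bar>eta n m k\<bar> \<le> \<bar>xi n m k\<bar>)"
    have k: "\<bar>eta n m k\<bar> \<le> \<bar>xi n m k\<bar>"
      unfolding k_def using first_cell by (rule LeastI_ex)
    have less: "\<bar>xi n m i\<bar> < \<bar>eta n m i\<bar>" if "i < k" for i
      using not_less_Least[of i "\<lambda>k. \<bar>eta n m k\<bar> \<le> \<bar>xi n m k\<bar>"] that by (simp add: k_def not_le)
    show "4 * (\<bar>of_int n\<bar> * err n m) \<ge> kappa - \<delta>"
    proof (cases "k \<le> L + 1")
      case True
      then show ?thesis using far_points[of k n m] N[OF True] n k assms by simp
    next
      case False
      then obtain i where i: "k = Suc i" "i \<ge> 1" by (cases k) auto
      show ?thesis
      proof (cases "\<bar>xi n m k\<bar> = 1")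
        case True
        have "eta n m k \<noteq> 0" using grid_odd[of n m k] by auto
        then have "\<bar>eta n m k\<bar> = 1" using True k by linarith
        then show ?thesis using vertex[OF i(1) True] less[of i] L[of k] i False by simp
      next
        case False
        then show ?thesis using non_vertex[OF i k] less[of i] i assms by simp
      qed
    qed
  qed
qed

lemma inhom_const_ge: "inhom_const \<alpha> (gamma_star \<alpha> a \<epsilon>) \<ge> ereal (kappa / 4)"
  unfolding inhom_const_def le_Liminf_iff
proof (intro allI impI)
  fix c assume c: "c < ereal (kappa / 4)"
  obtain r where r: "c < ereal r" "r < kappa / 4"
    using ereal_dense2[OF c] by auto
  obtain N :: real where N: "\<And>n m. \<bar>of_int n\<bar> \<ge> N \<Longrightarrow> 4 * (\<bar>of_int n\<bar> * err n m) \<ge> kappa - (kappa - 4 * r)"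
    using eventually_bound[of "kappa - 4 * r"] r by auto
  show "\<forall>\<^sub>F n in filtercomap abs at_top.
      c < ereal (of_int \<bar>n\<bar> * nearest_int_dist (of_int n * \<alpha> - gamma_star \<alpha> a \<epsilon>))"
    unfolding eventually_filtercomap_at_top_linorder
  proof (intro exI allI impI)
    fix n :: int assume "\<bar>n\<bar> \<ge> \<lceil>N\<rceil>"
    then have "\<bar>of_int n\<bar> \<ge> N" by linarith
    then have "r \<le> \<bar>of_int n\<bar> * err n (round (of_int n * \<alpha> - gamma_star \<alpha> a \<epsilon>))"
      using N[of n] by simp
    also have "err n (round (of_int n * \<alpha> - gamma_star \<alpha> a \<epsilon>)) = nearest_int_dist (of_int n * \<alpha> - gamma_star \<alpha> a \<epsilon>)"
      by (simp add: nearest_int_dist_def algebra_simps)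
    finally show "c < ereal (of_int \<bar>n\<bar> * nearest_int_dist (of_int n * \<alpha> - gamma_star \<alpha> a \<epsilon>))"
      using r(1) by (metis ereal_less_eq(3) less_le_trans of_int_abs)
  qed
qed

end

theorem theorem3:
  fixes \<alpha> :: real and a \<epsilon> :: "nat \<Rightarrow> int"
  assumes "\<alpha> \<notin> \<rat>"
    and "adjusted_nearest_integer_expansion \<alpha> a \<epsilon>"
  shows "inhom_const \<alpha> (gamma_star \<alpha> a \<epsilon>) \<ge>
           ereal ((sqrt 10 - 3) * (7 - sqrt 13) / (31 - 2 * sqrt 10 - 3 * sqrt 13))
         \<and> (sqrt 10 - 3) * (7 - sqrt 13) / (31 - 2 * sqrt 10 - 3 * sqrt 13)
             \<in> {1 / 25.160 <.. 1 / (25.159 :: real)}"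
proof -
  interpret adjusted_expansion \<alpha> a \<epsilon> using assms by unfold_locales
  have "kappa / 4 = (sqrt 10 - 3) * (7 - sqrt 13) / (31 - 2 * sqrt 10 - 3 * sqrt 13)"
    unfolding kappa_def by (rule nonzero_mult_div_cancel_left) simp
  then show ?thesis using inhom_const_ge kappa_interval by metis
qed

end
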